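(* Let $$A = x^a(x+1)^b \prod_{i=1}^{13} M_i^{c_i}\cdot \prod_{j=1}^{15} S_j^{d_j} = x^a(x+1)^b\, A_1 \in \mathbb{F}_2[x],$$ where $a,b,c_i,d_j$ are nonnegative integers, $a\ge 1$, $b\ge 1$, and $A_1 := \prod_{i=1}^{13} M_i^{c_i}\prod_{j=1}^{15} S_j^{d_j}\neq 1$. Then $A$ is an (indecomposable) perfect polynomial if and only if $A\in\{T_1,\ldots,T_{11}\}$ and $\overline{A}\in\{T_1,\ldots,T_{11}\}$.
   Context: All polynomials are in $\mathbb{F}_2[x]$. For nonzero $A$, $\sigma(A)$ is the sum of all divisors of $A$; $A$ is perfect if $\sigma(A)=A$, and a perfect polynomial is indecomposable if it is not the product of two coprime nonconstant perfect polynomials. For a polynomial $S$, $\overline{S}(x):=S(x+1)$. For $Q\in\mathbb{F}_2[x]$ and positive integers $a,b,c$, put $Q^{abc}:=1+x^a(x+1)^bQ^c$ (this is notation, not a power). Define $M_1=1+x+x^2$, $M_2=1+x+x^3$, $M_3=1+x^2+x^3$, $M_4=1+x+x^2+x^3+x^4$, $M_5=1+x^3+x^4$, $M_6=1+x^3+x^5$, $M_7=1+x^3+x^7$, $M_8=1+x^6+x^7$, $M_9=\overline{M_6}$, $M_{10}=\overline{M_7}$, $M_{11}=\overline{M_8}$, $M_{12}=x^9+x+1$, $M_{13}=x^9+x^8+1$; $S_1=M_1^{111}$, $S_2=M_1^{221}$, $S_3=M_1^{134}$, $S_4=M_1^{311}$, $S_5=M_1^{131}$, $S_6=M_1^{314}$,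 $S_7=M_1^{113}$, $S_8=M_1^{331}$, $S_9=M_1^{115}$, $S_{10}=M_1^{411}$, $S_{11}=M_1^{121}$, $S_{12}=M_1^{212}$, $S_{13}=M_1^{141}$, $S_{14}=M_1^{211}$, $S_{15}=M_1^{122}$ (e.g. $S_1=1+x(x+1)(1+x+x^2)=1+x+x^4$); $T_1=x^2(x+1)M_1$, $T_2=\overline{T_1}$, $T_3=x^4(x+1)^3M_4$, $T_4=\overline{T_3}$, $T_5=x^4(x+1)^4M_4\overline{M_4}$, $T_6=x^6(x+1)^3M_2\overline{M_2}$, $T_7=\overline{T_6}$, $T_8=x^4(x+1)^6M_2\overline{M_2}M_4$, $T_9=\overline{T_8}$, $T_{10}=x^2(x+1)(x^4+x+1)M_1^2$, $T_{11}=\overline{T_{10}}$. *)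

theory Defs
  imports
    Complex_Main
    "HOL-Library.Z2"
    "HOL-Computational_Algebra.Polynomial"
begin

text \<open>Over the two-element field the only unit is 1, so the set of all divisors of a nonzero
  polynomial is finite and coincides with the set of its monic divisors.\<close>

definition sigma :: "bit poly \<Rightarrow> bit poly" where
  "sigma A = (\<Sum>D | D dvd A. D)"

definition perfect :: "bit poly \<Rightarrow> bool" where
  "perfect A \<longleftrightarrow> A \<noteq> 0 \<and> sigma A = A"

definition indecomposable_perfect :: "bit poly \<Rightarrow> bool" where
  "indecomposable_perfect A \<longleftrightarrow> perfect A \<and>
     \<not> (\<exists>B C. A = B * C \<and> coprime B C \<and> degree B > 0 \<and> degree C > 0 \<and> perfect B \<and> perfect C)"

abbreviation X :: "bit poly" where
  "X \<equiv> [:0, 1:]"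

definition bar :: "bit poly \<Rightarrow> bit poly" where
  "bar P = pcompose P (X + 1)"

definition triple :: "bit poly \<Rightarrow> nat \<Rightarrow> nat \<Rightarrow> nat \<Rightarrow> bit poly" where
  "triple Q a b c = 1 + X ^ a * (X + 1) ^ b * Q ^ c"

text \<open>The families below are indexed from 1; they are meaningful only for indices
  up to 13, 15 and 11 respectively.\<close>

definition M :: "nat \<Rightarrow> bit poly" where
  "M i =
    [1 + X + X ^ 2,
     1 + X + X ^ 3,
     1 + X ^ 2 + X ^ 3,
     1 + X + X ^ 2 + X ^ 3 + X ^ 4,
     1 + X ^ 3 + X ^ 4,
     1 + X ^ 3 + X ^ 5,
     1 + X ^ 3 + X ^ 7,
     1 + X ^ 6 + X ^ 7,
     bar (1 + X ^ 3 + X ^ 5),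
     bar (1 + X ^ 3 + X ^ 7),
     bar (1 + X ^ 6 + X ^ 7),
     X ^ 9 + X + 1,
     X ^ 9 + X ^ 8 + 1] ! (i - 1)"

definition S :: "nat \<Rightarrow> bit poly" where
  "S j =
    [triple (M 1) 1 1 1,
     triple (M 1) 2 2 1,
     triple (M 1) 1 3 4,
     triple (M 1) 3 1 1,
     triple (M 1) 1 3 1,
     triple (M 1) 3 1 4,
     triple (M 1) 1 1 3,
     triple (M 1) 3 3 1,
     triple (M 1) 1 1 5,
     triple (M 1) 4 1 1,
     triple (M 1) 1 2 1,
     triple (M 1) 2 1 2,
     triple (M 1) 1 4 1,
     triple (M 1) 2 1 1,
     triple (M 1) 1 2 2] ! (j - 1)"

definition T :: "nat \<Rightarrow> bit poly" where
  "T k =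
    [X ^ 2 * (X + 1) * M 1,
     bar (X ^ 2 * (X + 1) * M 1),
     X ^ 4 * (X + 1) ^ 3 * M 4,
     bar (X ^ 4 * (X + 1) ^ 3 * M 4),
     X ^ 4 * (X + 1) ^ 4 * M 4 * bar (M 4),
     X ^ 6 * (X + 1) ^ 3 * M 2 * bar (M 2),
     bar (X ^ 6 * (X + 1) ^ 3 * M 2 * bar (M 2)),
     X ^ 4 * (X + 1) ^ 6 * M 2 * bar (M 2) * M 4,
     bar (X ^ 4 * (X + 1) ^ 6 * M 2 * bar (M 2) * M 4),
     X ^ 2 * (X + 1) * (X ^ 4 + X + 1) * M 1 ^ 2,
     bar (X ^ 2 * (X + 1) * (X ^ 4 + X + 1) * M 1 ^ 2)] ! (k - 1)"

end

theory Submission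
  imports Defs "HOL-Computational_Algebra.Polynomial_Factorial" "HOL-Library.FuncSet"
begin

text \<open> Write \<open>A\<close> as a product of powers \<open>P\<^sub>i\<close>\<open>^e\<^sub>i\<close> of the thirty irreducible polynomials \<open>x\<close>,
  \<open>x + 1\<close>, \<open>M\<^sub>1\<close>, \<dots>, \<open>S\<^sub>1\<^sub>5\<close>, and each \<open>e\<^sub>i + 1 = 2^h u\<close> with \<open>u\<close> odd. In characteristic two
  \<open>\<sigma>(P^e) = (1 + P)^(2^h - 1) \<sigma>(P^(u - 1))^(2^h)\<close>, so if \<open>A\<close> is perfect, \<open>\<sigma>(P^(u - 1))\<close> splits
  into polynomials of the list. A prime \<open>Q\<close> of degree \<open>k\<close> divides \<open>\<sigma>(P^(u - 1))\<close> only if \<open>u\<close> and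
  \<open>2^k - 1\<close> have a common factor, and then only once, since a multiple factor would divide the
  derivative of \<open>P\<close>, whose prime factors in the list divide \<open>P + 1\<close>; comparing degrees leaves
  finitely many pairs \<open>(P, u)\<close>. Comparing the multiplicities of the thirty primes in \<open>\<sigma>(A) = A\<close>
  gives a linear system in the powers of two \<open>2^h\<close>. A sum of few powers of two that is itself
  \<open>2^h\<close> or \<open>3 \<cdot> 2^h\<close> has bounded terms, so apart from the family \<open>x^n (x + 1)^n\<close> the system has
  finitely many solutions: the exponents of \<open>T\<^sub>1, \<dots>, T\<^sub>1\<^sub>1\<close>. Indecomposability follows since a
  nonconstant perfect divisor is again of one of these shapes, hence divisible by \<open>x\<close>. \<close>

section \<open>Arithmetic on coefficient lists\<close>

text \<open>The first obstacle is that the odd parts \<open>u\<close> are a priori unbounded. Since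
  \<open>geo d P\<close> divides \<open>geo u P\<close> whenever \<open>d dvd u\<close>, splitting
  over the list passes to divisors, and only minimal forbidden \<open>u\<close> need to be examined.
  The degrees in the list are 1 to 9 and 12. A prime that divides no \<open>2^k - 1\<close> with
  such a \<open>k\<close> would leave its sum without any factor in the list; this confines the
  prime factors of \<open>u\<close> to 3, 5, 7, 13, 17, 31, 73 and 127. In the linear system, every
  equation except those of \<open>x\<close>, \<open>x + 1\<close> and \<open>M 1\<close> reads
  \<open>2^h u = 1 + ...\<close> with at most five powers of two on the right and \<open>u\<close>
  in {1, 3}. The constant 1, which comes from \<open>e + 1\<close>, anchors the bounds: without it
  all unknowns could be scaled together. If \<open>x\<close> and \<open>x + 1\<close> both have odd
  part 1, their 2-parts cancel against each other in the two equations and stay unbounded; this is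
  how the infinite family escapes the enumeration.\<close>

text \<open>Coefficient lists have the constant term first. Moduli are lists ending in \<open>True\<close>, and
  residues are padded to length exactly the degree of the modulus. The checkers avoid
  higher-order combinators because the simplifier would unfold their bodies symbolically under
  the binder.\<close>

fun bp :: "bool list \<Rightarrow> bit poly" where
  "bp [] = 0"
| "bp (b # bs) = pCons (of_bool b) (bp bs)"

fun addb :: "bool list \<Rightarrow> bool list \<Rightarrow> bool list" where
  "addb [] ys = ys"
| "addb (x # xs) [] = x # xs"
| "addb (x # xs) (y # ys) = (if x then \<not> y else y) # addb xs ys"

fun mulb :: "bool list \<Rightarrow> bool list \<Rightarrow> bool list" where
  "mulb [] ys = []"
| "mulb (x # xs) ys = (if x then addb ys (False # mulb xs ys) else False # mulb xs ys)"

text \<open>One step of long division. The input is one entry longer than a residue; its last entry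
  is the coefficient at the degree of the modulus, and \<open>butlast\<close> drops it once it has
  been cancelled.\<close>

definition redb :: "bool list \<Rightarrow> bool list \<Rightarrow> bool list" where
  "redb ms r = (if last r then butlast (addb r ms) else butlast r)"

text \<open>Horner's scheme with a reduction after each multiplication by \<open>x\<close>; the base
  case is zero, padded to the length of a residue.\<close>

fun modb :: "bool list \<Rightarrow> bool list \<Rightarrow> bool list" where
  "modb ms [] = map (\<lambda>_. False) (tl ms)"
| "modb ms (b # bs) = redb ms (b # modb ms bs)"

fun mulmodb :: "bool list \<Rightarrow> bool list \<Rightarrow> bool list \<Rightarrow> bool list" where
  "mulmodb ms [] ys = map (\<lambda>_. False) (tl ms)"
| "mulmodb ms (x # xs) ys = (if x then addb ys (redb ms (False # mulmodb ms xs ys)) else redb ms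
    (False # mulmodb ms xs ys))"

lemma poly_bit_two [simp]: "(2 :: bit poly) = 0"
  by (simp add: numeral_poly)

lemma poly_bit_add_self [simp]: "(p :: bit poly) + p = 0"
  by (simp flip: mult_2)

lemma poly_bit_add_self_left [simp]: "(p :: bit poly) + (p + q) = q"
  by (simp flip: add.assoc)

lemma poly_bit_uminus [simp]: "- p = (p :: bit poly)"
  by (simp add: poly_eq_iff)

lemma poly_bit_diff: "p - q = (p :: bit poly) + q"
  using add_uminus_conv_diff[of p q] by simp

lemma bp_addb [simp]: "bp (addb xs ys) = bp xs + bp ys"
  by (induction xs ys rule: addb.induct) auto

lemma bp_mulb [simp]: "bp (mulb xs ys) = bp xs * bp ys"
  by (induction xs ys rule: mulb.induct) auto

lemma bp_map_False [simp]: "bp (map (\<lambda>_. False) xs) = 0"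
  by (induction xs) auto

lemma length_addb [simp]: "length (addb xs ys) = max (length xs) (length ys)"
  by (induction xs ys rule: addb.induct) auto

lemma addb_eq_Nil [simp]: "addb xs ys = [] \<longleftrightarrow> xs = [] \<and> ys = []"
  by (cases "(xs, ys)" rule: addb.cases) auto

lemma bp_snoc: "bp (xs @ [b]) = bp xs + monom (of_bool b) (length xs)"
  by (induction xs) (auto simp: monom_Suc monom_0)

lemma last_addb: "length xs = length ys \<Longrightarrow> xs \<noteq> [] \<Longrightarrow> last (addb xs ys) = (last xs \<noteq> last ys)"
  by (induction xs ys rule: addb.induct) auto

lemma bp_butlast:
  assumes "xs \<noteq> []" "\<not> last xs" shows "bp (butlast xs) = bp xs"
proof -
  have "bp xs = bp (butlast xs @ [last xs])" using assms(1) by simp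
  also have "\<dots> = bp (butlast xs)" using assms(2) by (simp only: bp_snoc) simp
  finally show ?thesis ..
qed

lemma degree_bp_less: "xs \<noteq> [] \<Longrightarrow> degree (bp xs) < length xs"
proof (induction xs)
  case (Cons b xs)
  then show ?case by (cases "xs = []") (auto simp: degree_pCons_eq_if)
qed simp

lemma degree_bp:
  assumes "xs \<noteq> []" "last xs" shows "degree (bp xs) = length xs - 1" "bp xs \<noteq> 0"
  using assms by (induction xs) (auto simp: degree_pCons_eq_if split: if_splits)

lemma redb:
  assumes "last ms" "ms \<noteq> []" "length r = length ms"
  shows "bp ms dvd bp (redb ms r) + bp r" "length (redb ms r) = length ms - 1"
proof -
  have "r \<noteq> []" using assms by auto
  with assms show "bp ms dvd bp (redb ms r) + bp r" "length (redb ms r) = length ms - 1"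
    by (auto simp: redb_def bp_butlast last_addb ac_simps)
qed

text \<open>In characteristic two \<open>p dvd q + r\<close> says that \<open>q\<close> and
  \<open>r\<close> are congruent modulo \<open>p\<close>; this is transitivity.\<close>

lemma bit_poly_dvd_trans_add:
  fixes p q r s :: "bit poly"
  shows "p dvd q + r \<Longrightarrow> p dvd r + s \<Longrightarrow> p dvd q + s"
  using dvd_add[of p "q + r" "r + s"] by (simp add: ac_simps)

lemma modb:
  assumes "last ms" "ms \<noteq> []"
  shows "bp ms dvd bp (modb ms xs) + bp xs \<and> length (modb ms xs) = length ms - 1"
proof (induction xs)
  case Nil
  then show ?case by simp
next
  case (Cons b bs)
  have l: "length (b # modb ms bs) = length ms" using Cons assms by simp
  have "bp (b # modb ms bs) + bp (b # bs) = (bp (modb ms bs) + bp bs) * X" by simp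
  moreover have "bp ms dvd (bp (modb ms bs) + bp bs) * X" using Cons by (intro dvd_mult2) simp
  ultimately have "bp ms dvd bp (b # modb ms bs) + bp (b # bs)" by metis
  from bit_poly_dvd_trans_add[OF redb(1)[OF assms l] this] redb(2)[OF assms l]
  show ?case by simp
qed

lemma mulmodb:
  assumes "last ms" "ms \<noteq> []" "length ys = length ms - 1"
  shows "bp ms dvd bp (mulmodb ms xs ys) + bp xs * bp ys \<and> length (mulmodb ms xs ys) = length ms -
      1"
proof (induction xs)
  case Nil
  then show ?case by simp
next
  case (Cons b bs)
  let ?r = "mulmodb ms bs ys"
  have l: "length (False # ?r) = length ms" using Cons assms by simp
  have "bp (False # ?r) + bp (False # bs) * bp ys = (bp ?r + bp bs * bp ys) * X"
    by (simp add: algebra_simps)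
  moreover have "bp ms dvd (bp ?r + bp bs * bp ys) * X" using Cons by (intro dvd_mult2) simp
  ultimately have "bp ms dvd bp (False # ?r) + bp (False # bs) * bp ys" by metis
  note * = bit_poly_dvd_trans_add[OF redb(1)[OF assms(1,2) l] this]
  have "bp (mulmodb ms (b # bs) ys) + bp (b # bs) * bp ys
      = bp (redb ms (False # ?r)) + bp (False # bs) * bp ys"
    by (simp add: ac_simps)
  with * redb(2)[OF assms(1,2) l] assms(3) show ?case by simp
qed

section \<open>Trial division and geometric sums modulo a polynomial\<close>

fun nonzerob :: "bool list \<Rightarrow> bool" where
  "nonzerob [] = False"
| "nonzerob (x # xs) = (if x then True else nonzerob xs)"

lemma bp_eq_0_iff: "bp xs = 0 \<longleftrightarrow> \<not> nonzerob xs"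
  by (induction xs) auto

fun monics :: "nat \<Rightarrow> bool list list" where
  "monics 0 = [[True]]"
| "monics (Suc n) = map (Cons False) (monics n) @ map (Cons True) (monics n)"

fun no_divisor :: "bool list \<Rightarrow> bool list list \<Rightarrow> bool" where
  "no_divisor xs [] = True"
| "no_divisor xs (ms # mss) = (nonzerob (modb ms xs) \<and> no_divisor xs mss)"

fun no_divisor_upto :: "bool list \<Rightarrow> nat \<Rightarrow> bool" where
  "no_divisor_upto xs 0 = True"
| "no_divisor_upto xs (Suc d) = (no_divisor xs (monics (Suc d)) \<and> no_divisor_upto xs d)"

definition irreducibleb :: "bool list \<Rightarrow> bool" where
  "irreducibleb xs = (xs \<noteq> [] \<and> last xs \<and> tl xs \<noteq> [] \<and> no_divisor_upto xs ((length xs - 1) div 2))"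

fun geomodb :: "bool list \<Rightarrow> bool list \<Rightarrow> nat \<Rightarrow> bool list" where
  "geomodb ms xs 0 = map (\<lambda>_. False) (tl ms)"
| "geomodb ms xs (Suc n) = addb [True] (mulmodb ms xs (geomodb ms xs n))"

section \<open>Products of irreducible polynomials\<close>

lemma is_unit_bit_poly [simp]: "is_unit (p :: bit poly) \<longleftrightarrow> p = 1"
proof
  assume "is_unit p"
  then obtain c where "p = [:c:]" "c dvd 1" unfolding is_unit_poly_iff by blast
  then show "p = 1" by (cases c) auto
qed simp

locale irreducible_family =
  fixes I :: "'i set" and P :: "'i \<Rightarrow> bit poly"
  assumes finite_I: "finite I"
    and irreducible_P: "i \<in> I \<Longrightarrow> irreducible (P i)"
    and inj_P: "inj_on P I"
begin

lemma prime_elem_P: "i \<in> I \<Longrightarrow> prime_elem (P i)"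
  by (intro field_poly_irreducible_imp_prime irreducible_P)

lemma P_neq_0: "i \<in> I \<Longrightarrow> P i \<noteq> 0"
  using irreducible_P by (metis irreducible_def)

lemma P_dvd_P_iff:
  assumes ij: "i \<in> I" "j \<in> I"
  shows "P i dvd P j \<longleftrightarrow> i = j"
proof
  assume "P i dvd P j"
  then obtain c where c: "P j = P i * c" by (rule dvdE)
  have "P i \<noteq> 1" using irreducible_not_unit[OF irreducible_P[OF ij(1)]] by simp
  then have "c = 1" using irreducibleD[OF irreducible_P[OF ij(2)] c] by simp
  then have "P i = P j" by (simp add: c)
  with ij inj_P show "i = j" by (meson inj_onD)
qed simp

lemma P_dvd_prod_imp:
  assumes "J \<subseteq> I" "i \<in> I" "P i dvd (\<Prod>j\<in>J. P j ^ f j)"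
  shows "i \<in> J"
proof -
  have "finite J" using assms(1) finite_I by (rule finite_subset)
  from this assms(1,3) show ?thesis
  proof (induction J rule: finite_induct)
    case empty
    then show ?case using irreducible_not_unit[OF irreducible_P[OF assms(2)]] by simp
  next
    case (insert j J)
    then have "P i dvd P j ^ f j * (\<Prod>j\<in>J. P j ^ f j)" by simp
    then consider "P i dvd P j ^ f j" | "P i dvd (\<Prod>j\<in>J. P j ^ f j)"
      using prime_elem_dvd_multD[OF prime_elem_P[OF assms(2)]] by blast
    then show ?case
    proof cases
      case 1
      then have "P i dvd P j" by (rule prime_elem_dvd_power[OF prime_elem_P[OF assms(2)]])
      with P_dvd_P_iff[of i j] insert.prems assms(2) show ?thesis by simp
    next
      case 2
      with insert.IH insert.prems show ?thesis by simp
    qed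
  qed
qed

lemma P_power_dvd_prod_iff:
  assumes "i \<in> I"
  shows "P i ^ n dvd (\<Prod>j\<in>I. P j ^ f j) \<longleftrightarrow> n \<le> f i"
proof -
  let ?R = "\<Prod>j\<in>I - {i}. P j ^ f j"
  have eq: "(\<Prod>j\<in>I. P j ^ f j) = P i ^ f i * ?R"
    using assms finite_I by (simp add: prod.remove)
  show ?thesis
  proof
    assume d: "P i ^ n dvd (\<Prod>j\<in>I. P j ^ f j)"
    show "n \<le> f i"
    proof (rule ccontr)
      assume "\<not> n \<le> f i"
      then have "P i ^ n = P i ^ f i * (P i * P i ^ (n - f i - 1))"
        by (simp flip: power_add power_Suc)
      with d P_neq_0[OF assms] have "P i * P i ^ (n - f i - 1) dvd ?R" unfolding eq by simp
      then have "P i dvd ?R" by (rule dvd_mult_left)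
      with P_dvd_prod_imp[of "I - {i}" i f] assms show False by auto
    qed
  qed (simp add: eq le_imp_power_dvd)
qed

lemma prod_P_inject: "(\<Prod>j\<in>I. P j ^ f j) = (\<Prod>j\<in>I. P j ^ g j) \<longleftrightarrow> (\<forall>i\<in>I. f i = g i)"
proof
  assume "(\<Prod>j\<in>I. P j ^ f j) = (\<Prod>j\<in>I. P j ^ g j)"
  then have "\<forall>i\<in>I. \<forall>n. n \<le> f i \<longleftrightarrow> n \<le> g i" using P_power_dvd_prod_iff by metis
  then show "\<forall>i\<in>I. f i = g i" by (metis order_antisym order_refl)
qed (simp cong: prod.cong)

text \<open>Each copy of \<open>p\<close> divides \<open>D\<close> or its cofactor and is cancelled
  there.\<close>

lemma dvd_prime_power_mult:
  fixes p :: "bit poly"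
  assumes "prime_elem p" "D dvd p ^ n * R"
  shows "\<exists>k\<le>n. \<exists>D'. D = p ^ k * D' \<and> D' dvd R"
  using assms(2)
proof (induction n arbitrary: D)
  case (Suc n)
  then obtain E where E: "D * E = p * (p ^ n * R)" by (metis dvdE mult.assoc power_Suc)
  have p: "p \<noteq> 0" using assms(1) by auto
  have "p dvd D * E" unfolding E by simp
  with assms(1) consider "p dvd D" | "p dvd E" by (auto simp: prime_elem_dvd_mult_iff)
  then show ?case
  proof cases
    case 1
    then obtain D1 where D1: "D = p * D1" by auto
    with E p have "D1 * E = p ^ n * R" by (simp add: mult.assoc)
    then have "D1 dvd p ^ n * R" by (metis dvd_triv_left)
    from Suc.IH[OF this] obtain k D' where "k \<le> n" "D1 = p ^ k * D'" "D' dvd R" by blast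
    then show ?thesis using D1 by (intro exI[of _ "Suc k"]) (auto simp: mult.assoc)
  next
    case 2
    then obtain E1 where "E = p * E1" by auto
    with E p have "D * E1 = p ^ n * R" by (simp add: mult.left_commute)
    then have "D dvd p ^ n * R" by (metis dvd_triv_left)
    from Suc.IH[OF this] show ?thesis using le_Suc_eq by blast
  qed
qed auto

lemma dvd_prod_P:
  assumes "D dvd (\<Prod>j\<in>I. P j ^ f j)"
  shows "\<exists>g. (\<forall>i\<in>I. g i \<le> f i) \<and> D = (\<Prod>j\<in>I. P j ^ g j)"
proof -
  have "\<exists>g. (\<forall>i\<in>J. g i \<le> f i) \<and> D = (\<Prod>j\<in>J. P j ^ g j)"
    if "finite J" "J \<subseteq> I" "D dvd (\<Prod>j\<in>J. P j ^ f j)" for J D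
    using that
  proof (induction J arbitrary: D rule: finite_induct)
    case (insert x F)
    then have "D dvd P x ^ f x * (\<Prod>j\<in>F. P j ^ f j)" by simp
    from dvd_prime_power_mult[OF prime_elem_P this] insert
    obtain k D' where k: "k \<le> f x" "D = P x ^ k * D'" "D' dvd (\<Prod>j\<in>F. P j ^ f j)" by auto
    with insert obtain g where g: "\<forall>i\<in>F. g i \<le> f i" "D' = (\<Prod>j\<in>F. P j ^ g j)" by auto
    have "D' = (\<Prod>j\<in>F. P j ^ (g(x := k)) j)" unfolding g(2)
      using insert by (intro prod.cong) auto
    then show ?case using k g insert by (intro exI[of _ "g(x := k)"]) auto
  qed auto
  then show ?thesis using assms finite_I by blast
qed

text \<open>By unique factorisation the divisors correspond to the exponent functions in a box, and
  the sum over the box factors. The functions are taken extensional (\<open>PiE\<close>) so that the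
  correspondence is injective.\<close>

lemma sigma_prod_P: "sigma (\<Prod>i\<in>I. P i ^ f i) = (\<Prod>i\<in>I. \<Sum>k<Suc (f i). P i ^ k)"
proof -
  let ?G = "PiE I (\<lambda>i. {..<Suc (f i)})"
  let ?h = "\<lambda>g. \<Prod>i\<in>I. P i ^ g i"
  have "{D. D dvd ?h f} = ?h ` ?G"
  proof (intro equalityI subsetI)
    fix D assume "D \<in> {D. D dvd ?h f}"
    then obtain g where g: "\<forall>i\<in>I. g i \<le> f i" "D = ?h g" using dvd_prod_P by blast
    then have "restrict g I \<in> ?G" "?h (restrict g I) = D" by (auto cong: prod.cong)
    then show "D \<in> ?h ` ?G" by blast
  next
    fix D assume "D \<in> ?h ` ?G"
    then show "D \<in> {D. D dvd ?h f}"
      by (auto intro!: prod_dvd_prod le_imp_power_dvd dest!: PiE_mem simp: less_Suc_eq_le)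
  qed
  moreover have "inj_on ?h ?G"
    by (intro inj_onI) (auto simp: prod_P_inject intro: PiE_ext)
  ultimately have "sigma (?h f) = (\<Sum>g\<in>?G. ?h g)"
    by (simp add: sigma_def sum.reindex)
  also have "\<dots> = (\<Prod>i\<in>I. \<Sum>k<Suc (f i). P i ^ k)"
    using finite_I by (subst prod_sum_PiE) auto
  finally show ?thesis .
qed

end

section \<open>Geometric sums in characteristic two\<close>

text \<open>For irreducible \<open>p\<close> this is the divisor sum of \<open>p ^ (n - 1)\<close>.
  Indexing by the number of terms turns divisibility of indices into divisibility of the
  sums.\<close>

definition geo :: "nat \<Rightarrow> bit poly \<Rightarrow> bit poly" where
  "geo n p = (\<Sum>k<n. p ^ k)"

lemma geo_0 [simp]: "geo 0 p = 0" and geo_1 [simp]: "geo (Suc 0) p = 1"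
  by (simp_all add: geo_def)

lemma geo_Suc: "geo (Suc n) p = 1 + p * geo n p"
  unfolding geo_def sum.lessThan_Suc_shift by (simp add: sum_distrib_left)

lemma geo_mult: "(p + 1) * geo n p = p ^ n + 1"
  using power_diff_1_eq[of p n] by (simp add: geo_def poly_bit_diff)

lemma geo_dvd_geo:
  assumes "p \<noteq> 1" "d dvd n"
  shows "geo d p dvd geo n p"
proof -
  obtain k where k: "n = d * k" using assms by auto
  have p: "p + 1 \<noteq> 0"
    using assms(1) by (metis add.right_neutral poly_bit_add_self poly_bit_add_self_left)
  have "p ^ d + 1 dvd p ^ n + 1"
    unfolding k power_mult geo_mult[symmetric, of "p ^ d" k] by simp
  then show ?thesis using p by (simp add: geo_mult[symmetric])
qed

lemma freshman:
  fixes p q :: "bit poly"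
  shows "(p + q) ^ (2 ^ h) = p ^ (2 ^ h) + q ^ (2 ^ h)"
proof (induction h)
  case (Suc h)
  have sq: "(a + b)\<^sup>2 = a\<^sup>2 + b\<^sup>2" for a b :: "bit poly"
    by (simp add: power2_eq_square algebra_simps)
  have e: "a ^ (2 ^ Suc h) = (a ^ (2 ^ h))\<^sup>2" for a :: "bit poly"
    by (simp add: mult.commute[of 2] flip: power_mult)
  show ?case unfolding e Suc sq ..
qed simp

text \<open>After multiplication by \<open>p + 1\<close> both sides become
  \<open>(p ^ u + 1) ^ (2 ^ h)\<close>, by the Frobenius identity.\<close>

lemma geo_two_power_mult:
  assumes "p \<noteq> 1"
  shows "geo (2 ^ h * u) p = (p + 1) ^ (2 ^ h - 1) * geo u p ^ (2 ^ h)"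
proof -
  have p: "p + 1 \<noteq> 0"
    using assms(1) by (metis add.right_neutral poly_bit_add_self poly_bit_add_self_left)
  have "(p + 1) * geo (2 ^ h * u) p = (p ^ u + 1) ^ (2 ^ h)"
    by (simp add: geo_mult freshman mult.commute[of "2 ^ h"] power_mult)
  also have "\<dots> = (p + 1) ^ (2 ^ h) * geo u p ^ (2 ^ h)"
    by (simp flip: geo_mult power_mult_distrib)
  also have "(p + 1) ^ (2 ^ h) = (p + 1) * (p + 1) ^ (2 ^ h - 1)"
    by (simp flip: power_Suc)
  finally show ?thesis using p by (simp add: mult.assoc)
qed

text \<open>Modulo \<open>p + 1\<close> every power of \<open>p\<close> is 1, and an odd number of
  ones adds up to 1.\<close>

lemma dvd_geo_plus_one:
  assumes "odd n" shows "p + 1 dvd geo n p + 1"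
proof -
  obtain m where m: "n = Suc (2 * m)" using assms by (metis oddE Suc_eq_plus1)
  have e: "p + 1 dvd geo (2 * m) p" for m
  proof (induction m)
    case (Suc m)
    have "geo (2 * Suc m) p = (p + 1) + p * p * geo (2 * m) p"
      by (simp add: geo_Suc algebra_simps)
    then show ?case using Suc by (metis dvd_add dvd_mult dvd_refl)
  qed simp
  have "geo n p + 1 = p * geo (2 * m) p" by (simp add: m geo_Suc ac_simps)
  then show ?thesis using e by (metis dvd_mult)
qed

text \<open>The sum is congruent to 1 both modulo \<open>p + 1\<close> and modulo
  \<open>p\<close>.\<close>

lemma not_dvd_geo:
  assumes "irreducible q" "odd n" "q dvd geo n p"
  shows "\<not> q dvd p + 1" "\<not> q dvd p"
proof -
  have q: "q \<noteq> 1" using irreducible_not_unit[OF assms(1)] by auto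
  show "\<not> q dvd p + 1"
  proof
    assume "q dvd p + 1"
    then have "q dvd geo n p + (geo n p + 1)"
      using assms dvd_geo_plus_one dvd_trans dvd_add by metis
    with q show False by simp
  qed
  show "\<not> q dvd p"
  proof
    assume "q dvd p"
    obtain m where "n = Suc m" using assms(2) by (cases n) auto
    then have "geo n p + p * geo m p = 1" by (simp add: geo_Suc add.assoc)
    with \<open>q dvd p\<close> assms(3) have "q dvd 1" by (metis dvd_add dvd_mult2)
    with q show False by simp
  qed
qed

text \<open>Fermat's little theorem modulo \<open>q\<close>: the \<open>k\<close>-fold Frobenius is
  a ring homomorphism that fixes the constants, so if it fixes \<open>x\<close> it fixes every
  polynomial.\<close>

lemma dvd_two_power_plus:
  fixes q :: "bit poly"
  assumes "q dvd X ^ (2 ^ k) + X"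
  shows "q dvd p ^ (2 ^ k) + p"
proof (induction p)
  case (pCons a p)
  have a: "[:a:] ^ (2 ^ k) = [:a:]" by (cases a) (auto simp: one_pCons[symmetric])
  have "pCons a p = [:a:] + X * p" by simp
  then have "pCons a p ^ (2 ^ k) + pCons a p = ([:a:] + X * p) ^ (2 ^ k) + ([:a:] + X * p)" by
      (simp only:)
  also have "\<dots> = X ^ (2 ^ k) * (p ^ (2 ^ k) + p) + (X ^ (2 ^ k) + X) * p"
    unfolding freshman a power_mult_distrib by (simp add: algebra_simps)
  finally show ?case using pCons assms by (metis dvd_add dvd_mult dvd_mult2)
qed (simp add: power_0_left)

text \<open>Modulo \<open>q\<close> both \<open>p ^ n\<close> and \<open>p ^ (2 ^ k - 1)\<close> are
  1. Coprime exponents would give \<open>p = 1\<close> modulo \<open>q\<close>, but then the sum of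
  \<open>n\<close> terms, with \<open>n\<close> odd, would be 1 and not 0.\<close>

lemma dvd_geo_imp_not_coprime:
  assumes q: "irreducible q" "q dvd X ^ (2 ^ k) + X" and n: "odd n" "q dvd geo n p"
  shows "\<not> coprime n (2 ^ k - 1)"
proof
  assume c: "coprime n (2 ^ k - 1)"
  have pr: "prime_elem q" using q(1) by (rule field_poly_irreducible_imp_prime)
  let ?K = "2 ^ k - 1 :: nat"
  have "p ^ (2 ^ k) + p = p * (p ^ ?K + 1)"
    by (simp add: distrib_left flip: power_Suc)
  with dvd_two_power_plus[OF q(2), of p] pr not_dvd_geo(2)[OF q(1) n]
  have K: "q dvd p ^ ?K + 1" by (auto simp: prime_elem_dvd_mult_iff)
  have N: "q dvd p ^ n + 1" using n(2) by (simp flip: geo_mult)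
  have pw: "q dvd p ^ (a * b) + 1" if "q dvd p ^ a + 1" for a b
  proof -
    have "p ^ a + 1 dvd (p ^ a) ^ b + 1" by (simp flip: geo_mult)
    then show ?thesis using that by (metis dvd_trans power_mult)
  qed
  have "n \<noteq> 0" using n(1) by (cases n) auto
  with c obtain a b where ab: "n * a = ?K * b + 1"
    using bezout_nat[of n ?K] by (auto simp: coprime_iff_gcd_eq_1)
  have "p ^ (n * a) = p * p ^ (?K * b)" by (simp add: ab)
  then have "p + 1 = (p ^ (n * a) + 1) + p * (p ^ (?K * b) + 1)"
    by (simp add: algebra_simps)
  then have "q dvd p + 1" using pw[OF N, of a] pw[OF K, of b] by (metis dvd_add dvd_mult)
  with not_dvd_geo(1)[OF q(1) n] show False by simp
qed

text \<open>A square factor of \<open>p ^ n + 1\<close> leaves a factor \<open>q\<close> in its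
  derivative \<open>n * p ^ (n - 1) * pderiv p\<close>, where \<open>n\<close> is 1 in the field and
  \<open>q\<close> does not divide \<open>p\<close>.\<close>

lemma square_dvd_geo_imp_dvd_pderiv:
  assumes q: "irreducible q" and n: "odd n" and d: "q\<^sup>2 dvd geo n p"
  shows "q dvd pderiv p"
proof -
  have pr: "prime_elem q" using q(1) by (rule field_poly_irreducible_imp_prime)
  have d1: "q dvd geo n p" using d by (metis dvd_mult_left power2_eq_square)
  have "q\<^sup>2 dvd p ^ n + 1" using d by (simp flip: geo_mult)
  then obtain r where "p ^ n + 1 = q\<^sup>2 * r" by auto
  then have "pderiv (p ^ n + 1) = pderiv (q * (q * r))" by (simp add: power2_eq_square mult.assoc)
  also have "\<dots> = q * pderiv (q * r) + q * (r * pderiv q)" by (simp add: pderiv_mult algebra_simps)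
  finally have "q dvd pderiv (p ^ n + 1)" by simp
  moreover obtain m where m: "n = Suc m" using n by (cases n) auto
  moreover have "(of_nat n :: bit) = 1"
    using n by (induction n rule: nat_induct2) auto
  ultimately have "q dvd p ^ m * pderiv p"
    by (simp add: pderiv_add pderiv_power_Suc pderiv_1 del: of_nat_Suc power_Suc)
  with pr not_dvd_geo(2)[OF q n d1] show ?thesis
    by (auto simp: prime_elem_dvd_mult_iff dest: prime_elem_dvd_power)
qed

section \<open>Verified tests on coefficient lists\<close>

text \<open>A residue has smaller degree than the modulus, so the modulus divides it only if it is
  zero.\<close>

lemma residue_dvd_iff:
  assumes "ms \<noteq> []" "last ms" "bp ms dvd bp r + F" "length r = length ms - 1"
  shows "bp ms dvd F \<longleftrightarrow> \<not> nonzerob r"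
proof -
  have "bp ms dvd F \<longleftrightarrow> bp ms dvd bp r"
    using assms(3) by (metis add.commute dvd_add_left_iff)
  also have "\<dots> \<longleftrightarrow> bp r = 0"
  proof
    assume d: "bp ms dvd bp r"
    show "bp r = 0"
    proof (cases "r = []")
      case False
      show ?thesis
      proof (rule ccontr)
        assume "bp r \<noteq> 0"
        with d have "degree (bp ms) \<le> degree (bp r)" by (rule dvd_imp_degree_le)
        with degree_bp_less[OF False] degree_bp[OF assms(1,2)] assms(4) show False by simp
      qed
    qed simp
  qed simp
  also have "\<dots> \<longleftrightarrow> \<not> nonzerob r"
    by (simp add: bp_eq_0_iff)
  finally show ?thesis .
qed

lemma modb_dvd_iff:
  assumes "ms \<noteq> []" "last ms"
  shows "bp ms dvd bp xs \<longleftrightarrow> \<not> nonzerob (modb ms xs)"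
  using residue_dvd_iff[OF assms] modb[OF assms(2,1)] by blast

lemma geomodb:
  assumes "ms \<noteq> []" "last ms" "tl ms \<noteq> []"
  shows "bp ms dvd bp (geomodb ms xs n) + geo n (bp xs) \<and> length (geomodb ms xs n) = length ms - 1"
proof (induction n)
  case (Suc n)
  let ?r = "mulmodb ms xs (geomodb ms xs n)"
  have m: "bp ms dvd bp ?r + bp xs * bp (geomodb ms xs n)" "length ?r = length ms - 1"
    using mulmodb[OF assms(2,1)] Suc by blast+
  have "bp ms dvd bp xs * (bp (geomodb ms xs n) + geo n (bp xs))"
    using Suc by (blast intro: dvd_mult)
  then have "bp ms dvd bp xs * bp (geomodb ms xs n) + bp xs * geo n (bp xs)"
    by (simp add: distrib_left)
  from bit_poly_dvd_trans_add[OF m(1) this] have "bp ms dvd bp ?r + bp xs * geo n (bp xs)" .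
  \<comment> \<open>A residue for a nonconstant modulus has at least one entry, so adding the
    constant 1 does not lengthen it.\<close>
  moreover have "1 \<le> length ms - 1" using assms(1,3) by (cases ms; cases "tl ms") auto
  ultimately show ?case using m(2) by (simp add: geo_Suc ac_simps flip: one_pCons)
qed simp

lemma geomodb_dvd_iff:
  assumes "ms \<noteq> []" "last ms" "tl ms \<noteq> []"
  shows "bp ms dvd geo n (bp xs) \<longleftrightarrow> \<not> nonzerob (geomodb ms xs n)"
  using residue_dvd_iff[OF assms(1,2)] geomodb[OF assms] by blast

text \<open>Over the two-element field every nonzero leading coefficient is 1, so trial division by
  these lists meets every possible divisor.\<close>

lemma monics_complete: "c \<noteq> 0 \<Longrightarrow> degree c = d \<Longrightarrow> \<exists>ds\<in>set (monics d). bp ds = c"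
proof (induction d arbitrary: c)
  case 0
  then obtain b where "c = [:b:]" by (auto elim: degree_eq_zeroE)
  with 0 show ?case by (cases b) auto
next
  case (Suc d)
  obtain b c' where c: "c = pCons b c'" by (cases c)
  with Suc.prems have "c' \<noteq> 0" "degree c' = d" by (auto split: if_splits)
  from Suc.IH[OF this] obtain ds where "ds \<in> set (monics d)" "bp ds = c'" by blast
  then have "bp ((b = 1) # ds) = c" "(b = 1) # ds \<in> set (monics (Suc d))"
    unfolding c by (cases b; auto)+
  then show ?case by blast
qed

lemma monics_last: "ds \<in> set (monics d) \<Longrightarrow> ds \<noteq> [] \<and> last ds"
  by (induction d arbitrary: ds) auto

lemma no_divisor_iff: "no_divisor xs mss \<longleftrightarrow> (\<forall>ms\<in>set mss. nonzerob (modb ms xs))"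
  by (induction mss) auto

lemma no_divisor_uptoD: "no_divisor_upto xs n \<Longrightarrow> 0 < d \<Longrightarrow> d \<le> n \<Longrightarrow> no_divisor xs (monics d)"
  by (induction n) (auto simp: le_Suc_eq)

lemma irreducibleb_imp_irreducible:
  assumes "irreducibleb xs" shows "irreducible (bp xs)"
proof -
  have xs: "xs \<noteq> []" "last xs" "tl xs \<noteq> []"
    and nd: "no_divisor_upto xs ((length xs - 1) div 2)"
    using assms by (auto simp: irreducibleb_def)
  have deg: "degree (bp xs) = length xs - 1" "bp xs \<noteq> 0" using degree_bp[OF xs(1,2)] by auto
  have small: "c = 1" if "c dvd bp xs" "degree c \<le> (length xs - 1) div 2" for c
  proof (rule ccontr)
    assume c1: "c \<noteq> 1"
    have c0: "c \<noteq> 0" using that(1) deg(2) by auto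
    have "degree c > 0"
    proof (rule ccontr)
      assume "\<not> degree c > 0"
      then obtain b where "c = [:b:]" by (auto elim: degree_eq_zeroE)
      with c0 c1 show False by (cases b) auto
    qed
    with nd that(2) have "no_divisor xs (monics (degree c))" by (intro no_divisor_uptoD)
    moreover obtain ds where ds: "ds \<in> set (monics (degree c))" "bp ds = c"
      using monics_complete[OF c0 refl] by blast
    ultimately have "nonzerob (modb ds xs)" by (auto simp: no_divisor_iff)
    with modb_dvd_iff[of ds xs] monics_last[OF ds(1)] ds(2) that(1) show False by simp
  qed
  show ?thesis
  proof (rule irreducibleI)
    show "bp xs \<noteq> 0" by (fact deg(2))
    have "length xs - 1 > 0" using xs(1,3) by (cases xs) auto
    then show "\<not> is_unit (bp xs)" using deg(1) by auto
    fix a b assume ab: "bp xs = a * b"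
    then have "degree a + degree b = length xs - 1"
      using deg by (auto simp: degree_mult_eq)
    then consider "degree a \<le> (length xs - 1) div 2" | "degree b \<le> (length xs - 1) div 2" by
        linarith
    then show "is_unit a \<or> is_unit b" using small ab by cases auto
  qed
qed

section \<open>Frobenius test and derivative\<close>

definition squareb :: "bool list \<Rightarrow> bool list \<Rightarrow> bool list" where
  "squareb ms xs = mulmodb ms xs xs"

fun squaresb :: "bool list \<Rightarrow> bool list \<Rightarrow> nat \<Rightarrow> bool list" where
  "squaresb ms r 0 = r"
| "squaresb ms r (Suc n) = squareb ms (squaresb ms r n)"

lemma squaresb:
  assumes "ms \<noteq> []" "last ms" "length r = length ms - 1" "bp ms dvd bp r + p"
  shows "bp ms dvd bp (squaresb ms r n) + p ^ (2 ^ n) \<and> length (squaresb ms r n) = length ms - 1"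
proof (induction n)
  case (Suc n)
  let ?s = "squaresb ms r n"
  have m: "bp ms dvd bp (mulmodb ms ?s ?s) + bp ?s * bp ?s" "length (mulmodb ms ?s ?s) = length ms
      - 1"
    using mulmodb[OF assms(2,1)] Suc by blast+
  have "bp ms dvd (bp ?s + p ^ (2 ^ n)) * (bp ?s + p ^ (2 ^ n))" using Suc by (blast intro:
      dvd_mult)
  also have "\<dots> = bp ?s * bp ?s + p ^ (2 ^ Suc n)"
    by (simp add: algebra_simps power_add mult_2)
  finally show ?case using m bit_poly_dvd_trans_add by (auto simp: squareb_def)
qed (use assms in auto)

text \<open>Any irreducible polynomial of degree \<open>k\<close> divides
  \<open>X ^ (2 ^ k) + X\<close>; for the given moduli this is checked by \<open>k\<close>
  squarings. \<open>X\<close> is reduced first because it is not a residue for moduli of degree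
  one.\<close>

definition frobenius_trivialb :: "bool list \<Rightarrow> bool" where
  "frobenius_trivialb ms =
    (squaresb ms (modb ms [False, True]) (length ms - 1) = modb ms [False, True])"

lemma frobenius_trivialb:
  assumes "ms \<noteq> []" "last ms" "frobenius_trivialb ms"
  shows "bp ms dvd X ^ (2 ^ (length ms - 1)) + X"
proof -
  let ?r = "modb ms [False, True]"
  have r: "bp ms dvd bp ?r + X" "length ?r = length ms - 1"
    using modb[OF assms(2,1), of "[False, True]"] by auto
  have "bp ms dvd bp ?r + X ^ (2 ^ (length ms - 1))"
    using squaresb[OF assms(1,2) r(2,1), of "length ms - 1"] assms(3)
    by (simp add: frobenius_trivialb_def)
  then show ?thesis using r(1) bit_poly_dvd_trans_add by (metis add.commute)
qed

text \<open>The derivative of \<open>X ^ 2\<close> vanishes, so the list is consumed in pairs: odd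
  coefficients move down by one place and even ones disappear.\<close>

fun derivb :: "bool list \<Rightarrow> bool list" where
  "derivb (x # y # xs) = y # False # derivb xs"
| "derivb xs = []"

lemma bp_derivb: "bp (derivb xs) = pderiv (bp xs)"
  by (induction xs rule: derivb.induct) (auto simp: pderiv_pCons)

section \<open>Degree bound for geometric sums that split\<close>

context irreducible_family
begin

lemma degree_P_pos: "i \<in> I \<Longrightarrow> degree (P i) > 0"
  using irreducible_P[of i] by (metis P_neq_0 gr0I irreducible_not_unit is_unit_iff_degree)

lemma P_neq_1: "i \<in> I \<Longrightarrow> P i \<noteq> 1"
  using degree_P_pos by fastforce

text \<open>By \<open>deriv\<close>, a repeated factor would divide \<open>P i + 1\<close>, which is
  impossible for a factor of the sum. So the sum is squarefree and has at most the total degree of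
  the list members dividing it.\<close>

lemma degree_geo_le:
  assumes i: "i \<in> I" and u: "odd u" and dvd: "geo u (P i) dvd (\<Prod>j\<in>I. P j ^ e j)"
    and deriv: "\<And>j. j \<in> I \<Longrightarrow> P j dvd pderiv (P i) \<Longrightarrow> P j dvd P i + 1"
  shows "(u - 1) * degree (P i) \<le> (\<Sum>j\<in>I. if P j dvd geo u (P i) then degree (P j) else 0)"
proof -
  obtain g where g: "geo u (P i) = (\<Prod>j\<in>I. P j ^ g j)" using dvd_prod_P[OF dvd] by blast
  have le1: "g j \<le> 1" if j: "j \<in> I" for j
  proof (rule ccontr)
    assume "\<not> g j \<le> 1"
    then have sq: "(P j)\<^sup>2 dvd geo u (P i)" using P_power_dvd_prod_iff[OF j, of 2 g] g by simp
    then have "P j dvd geo u (P i)" by (metis dvd_mult_left power2_eq_square)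
    moreover have "P j dvd P i + 1"
      using square_dvd_geo_imp_dvd_pderiv[OF irreducible_P[OF j] u sq] deriv[OF j] by simp
    ultimately show False using not_dvd_geo(1)[OF irreducible_P[OF j] u] by blast
  qed
  have pos: "P j dvd geo u (P i)" if "j \<in> I" "g j > 0" for j
    using P_power_dvd_prod_iff[OF that(1), of 1 g] g that(2) by simp
  obtain v where v: "u = Suc v" using u by (cases u) auto
  have pu: "degree (P i ^ u) = u * degree (P i)" using P_neq_0[OF i] by (rule degree_power_eq)
  then have p: "degree (P i + 1) = degree (P i)" "degree (P i ^ u + 1) = u * degree (P i)"
    using degree_P_pos[OF i] v by (simp_all add: degree_add_eq_left del: power_Suc)
  have nz: "geo u (P i) \<noteq> 0" "P i + 1 \<noteq> 0"
    using P_neq_0 finite_I degree_P_pos[OF i] p(1) unfolding g by (auto simp del: add_eq_0_iff)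
  have "degree (geo u (P i)) + degree (P i) = u * degree (P i)"
    using degree_mult_eq[OF nz(2,1)] by (simp add: geo_mult p)
  then have "(u - 1) * degree (P i) = degree (\<Prod>j\<in>I. P j ^ g j)"
    unfolding g[symmetric] by (simp add: v)
  also have "\<dots> = (\<Sum>j\<in>I. g j * degree (P j))"
    using P_neq_0 by (simp add: degree_prod_eq_sum_degree degree_power_eq)
  also have "\<dots> \<le> (\<Sum>j\<in>I. if P j dvd geo u (P i) then degree (P j) else 0)"
  proof (rule sum_mono)
    fix j assume j: "j \<in> I"
    show "g j * degree (P j) \<le> (if P j dvd geo u (P i) then degree (P j) else 0)"
      using le1[OF j] pos[OF j] by (cases "g j") auto
  qed
  finally show ?thesis .
qed

end

section \<open>The thirty irreducible polynomials\<close>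

text \<open>Index 0 is \<open>x\<close>, index 1 is \<open>x + 1\<close>, indices 2 to 14 are \<open>M\<^sub>1\<close> to \<open>M\<^sub>1\<^sub>3\<close>, and indices 15
  to 29 are \<open>S\<^sub>1\<close> to \<open>S\<^sub>1\<^sub>5\<close>.\<close>

definition base_bits :: "bool list list" where
  "base_bits = map (map (\<lambda>n. n = (1::int)))
   [[0, 1],
    [1, 1],
    [1, 1, 1],
    [1, 1, 0, 1],
    [1, 0, 1, 1],
    [1, 1, 1, 1, 1],
    [1, 0, 0, 1, 1],
    [1, 0, 0, 1, 0, 1],
    [1, 0, 0, 1, 0, 0, 0, 1],
    [1, 0, 0, 0, 0, 0, 1, 1],
    [1, 0, 1, 1, 1, 1],
    [1, 0, 0, 0, 1, 1, 1, 1],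
    [1, 1, 0, 1, 0, 1, 0, 1],
    [1, 1, 0, 0, 0, 0, 0, 0, 0, 1],
    [1, 0, 0, 0, 0, 0, 0, 0, 1, 1],
    [1, 1, 0, 0, 1],
    [1, 0, 1, 1, 0, 1, 1],
    [1, 1, 1, 1, 1, 1, 1, 1, 1, 1, 1, 1, 1],
    [1, 0, 0, 1, 0, 0, 1],
    [1, 1, 0, 1, 1, 0, 1],
    [1, 0, 0, 1, 1, 0, 0, 1, 1, 0, 0, 1, 1],
    [1, 1, 0, 1, 1, 1, 1, 0, 1],
    [1, 0, 0, 1, 0, 1, 1, 0, 1],
    [1, 1, 0, 0, 1, 1, 0, 0, 1, 1, 0, 0, 1],
    [1, 0, 0, 0, 1, 0, 0, 1],
    [1, 1, 1, 0, 1, 1],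
    [1, 0, 1, 1, 1, 1, 1, 1],
    [1, 1, 1, 1, 0, 1, 1, 1],
    [1, 0, 1, 0, 0, 1],
    [1, 1, 0, 0, 0, 0, 0, 1]]"

fun dvd_any :: "nat list \<Rightarrow> nat \<Rightarrow> bool" where
  "dvd_any [] k = False"
| "dvd_any (n # ns) k = (if k mod n = 0 then True else dvd_any ns k)"

text \<open>Total degree of the primes in the last argument that divide \<open>geo u (bp xs)\<close>. Only those of
  degree divisible by an entry of \<open>os\<close>, the orders of 2 modulo the prime factors of \<open>u\<close>, are
  tested.\<close>

fun dividing_degree :: "bool list \<Rightarrow> nat \<Rightarrow> nat list \<Rightarrow> bool list list \<Rightarrow> nat" where
  "dividing_degree xs u os [] = 0"
| "dividing_degree xs u os (ms # mss) =
    (if dvd_any os (length ms - 1) then (if nonzerob (geomodb ms xs u) then 0 else length ms - 1)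
        else 0)
    + dividing_degree xs u os mss"

definition base :: "nat \<Rightarrow> bit poly" where
  "base i = bp (base_bits ! i)"

text \<open>Indices, with repetition, of the prime factors of \<open>P\<^sub>i + 1\<close>, and of \<open>1 + P\<^sub>i + \<dots> + P\<^sub>i^(u
  - 1)\<close> for every pair \<open>(i, u)\<close> with \<open>u > 1\<close> for which that sum splits over the list.\<close>

definition fac_succ :: "nat list list" where
  "fac_succ =
   [[1],
    [0],
    [0, 1],
    [0, 1, 1],
    [0, 0, 1],
    [0, 1, 1, 1],
    [0, 0, 0, 1],
    [0, 0, 0, 1, 1],
    [0, 0, 0, 1, 1, 1, 1],
    [0, 0, 0, 0, 0, 0, 1],
    [0, 0, 1, 1, 1],
    [0, 0, 0, 0, 1, 1, 1],
    [0, 1, 1, 1, 1, 1, 1],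
    [0, 1, 1, 1, 1, 1, 1, 1, 1],
    [0, 0, 0, 0, 0, 0, 0, 0, 1],
    [0, 1, 2],
    [0, 0, 1, 1, 2],
    [0, 1, 1, 1, 2, 2, 2, 2],
    [0, 0, 0, 1, 2],
    [0, 1, 1, 1, 2],
    [0, 0, 0, 1, 2, 2, 2, 2],
    [0, 1, 2, 2, 2],
    [0, 0, 0, 1, 1, 1, 2],
    [0, 1, 2, 2, 2, 2, 2],
    [0, 0, 0, 0, 1, 2],
    [0, 1, 1, 2],
    [0, 0, 1, 2, 2],
    [0, 1, 1, 1, 1, 2],
    [0, 0, 1, 2],
    [0, 1, 1, 2, 2]]"

definition fac_geo :: "((nat \<times> nat) \<times> nat list) list" where
  "fac_geo =
   [((0, 3), [2]),
    ((0, 5), [5]),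
    ((0, 7), [3, 4]),
    ((0, 9), [2, 18]),
    ((0, 13), [17]),
    ((0, 15), [2, 5, 6, 15]),
    ((1, 3), [2]),
    ((1, 5), [6]),
    ((1, 7), [3, 4]),
    ((1, 9), [2, 19]),
    ((1, 13), [20]),
    ((1, 15), [2, 5, 6, 15]),
    ((2, 3), [15]),
    ((2, 5), [22]),
    ((2, 7), [3, 4, 16]),
    ((2, 15), [5, 6, 15, 21, 22]),
    ((3, 3), [2, 6]),
    ((4, 3), [2, 5]),
    ((15, 3), [5, 6]),
    ((16, 3), [15, 21])]"

fun prodb :: "nat list \<Rightarrow> bool list" where
  "prodb [] = [True]"
| "prodb (i # is) = mulb (base_bits ! i) (prodb is)"

fun geob :: "bool list \<Rightarrow> nat \<Rightarrow> bool list" where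
  "geob xs 0 = []"
| "geob xs (Suc n) = addb [True] (mulb xs (geob xs n))"

fun check_fac_succ :: "bool list list \<Rightarrow> nat list list \<Rightarrow> bool" where
  "check_fac_succ (xs # xss) (l # ls) =
    (\<not> nonzerob (addb (addb [True] xs) (prodb l)) \<and> check_fac_succ xss ls)"
| "check_fac_succ xss ls = (xss = [] \<and> ls = [])"

fun check_fac_geo :: "((nat \<times> nat) \<times> nat list) list \<Rightarrow> bool" where
  "check_fac_geo [] = True"
| "check_fac_geo (((i, u), l) # fs) =
    (\<not> nonzerob (addb (geob (base_bits ! i) u) (prodb l)) \<and> check_fac_geo fs)"

fun derivative_ok :: "bool list \<Rightarrow> bool list list \<Rightarrow> bool" where
  "derivative_ok xs [] = True"
| "derivative_ok xs (ms # mss) =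
    ((if nonzerob (modb ms (derivb xs)) then True else \<not> nonzerob (modb ms (addb [True] xs)))
     \<and> derivative_ok xs mss)"

fun derivatives_ok :: "bool list list \<Rightarrow> bool" where
  "derivatives_ok [] = True"
| "derivatives_ok (xs # xss) = (derivative_ok xs base_bits \<and> derivatives_ok xss)"

text \<open>The strict inequality contradicts the degree bound for split sums, provided that
  \<open>os\<close> contains the orders of 2 modulo the primes dividing \<open>u\<close>.\<close>

fun excluded :: "nat \<Rightarrow> nat list \<Rightarrow> nat list \<Rightarrow> bool" where
  "excluded u os [] = True"
| "excluded u os (i # is) = (dividing_degree (base_bits ! i) u os base_bits < (u - 1) * (length
    (base_bits ! i) - 1) \<and> excluded u os is)"

lemma irreducible_base_bits: "list_all irreducibleb base_bits" by code_simp
lemma frobenius_base_bits: "list_all frobenius_trivialb base_bits" by code_simp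
lemma distinct_base_bits: "distinct base_bits" by code_simp
lemma derivatives_base_bits: "derivatives_ok base_bits" by code_simp
lemma fac_succ_correct: "check_fac_succ base_bits fac_succ" by code_simp
lemma fac_geo_correct: "check_fac_geo fac_geo" by code_simp

text \<open>In this series a composite \<open>u\<close> is tested only at indices where its proper
  divisors survive, and 13 and 17 only where the cheaper \<open>compatible_degree\<close> does not
  decide.\<close>

lemma excluded_3: "excluded 3 [2] ([5..<15] @ [17..<30])" by code_simp
lemma excluded_5: "excluded 5 [4] [3..<30]" by code_simp
lemma excluded_7: "excluded 7 [3] [3..<30]" by code_simp
lemma excluded_13: "excluded 13 [12] [2, 3, 4]" by code_simp
lemma excluded_17: "excluded 17 [8] [0, 1]" by code_simp
lemma excluded_9: "excluded 9 [2] [2, 3, 4, 15, 16]" by code_simp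
lemma excluded_21: "excluded 21 [2, 3] [0, 1, 2]" by code_simp
lemma excluded_25: "excluded 25 [4] [0, 1, 2]" by code_simp
lemma excluded_27: "excluded 27 [2] [0, 1]" by code_simp
lemma excluded_35: "excluded 35 [4, 3] [0, 1, 2]" by code_simp
lemma excluded_39: "excluded 39 [2, 12] [0, 1]" by code_simp
lemma excluded_45: "excluded 45 [2, 4] [0, 1]" by code_simp
lemma excluded_49: "excluded 49 [3] [0, 1, 2]" by code_simp
lemma excluded_65: "excluded 65 [4, 12] [0, 1]" by code_simp

section \<open>Excluding odd cofactors\<close>

lemma length_base_bits [simp]: "length base_bits = 30"
  by (simp add: base_bits_def)

lemma base_bits_nth:
  assumes "i < 30"
  shows "base_bits ! i \<noteq> []" "last (base_bits ! i)" "tl (base_bits ! i) \<noteq> []" "irreducible (base i)"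
    "frobenius_trivialb (base_bits ! i)"
  using assms irreducible_base_bits frobenius_base_bits irreducibleb_imp_irreducible
  by (auto simp: list_all_length irreducibleb_def base_def)

lemma bp_inject_length: "length xs = length ys \<Longrightarrow> bp xs = bp ys \<Longrightarrow> xs = ys"
  by (induction xs ys rule: list_induct2) (auto split: if_splits)

lemma bp_inject:
  assumes "xs \<noteq> []" "last xs" "ys \<noteq> []" "last ys" "bp xs = bp ys"
  shows "xs = ys"
proof (rule bp_inject_length)
  have "length xs - 1 = length ys - 1" using degree_bp(1) assms by metis
  with assms show "length xs = length ys" by (cases xs; cases ys) auto
qed fact

lemma degree_base: "i < 30 \<Longrightarrow> degree (base i) = length (base_bits ! i) - 1"
  using base_bits_nth degree_bp by (simp add: base_def)

interpretation base: irreducible_family "{..<30}" base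
proof
  show "inj_on base {..<30}"
  proof (rule inj_onI)
    fix i j :: nat assume ij: "i \<in> {..<30}" "j \<in> {..<30}" "base i = base j"
    then have "base_bits ! i = base_bits ! j" using base_bits_nth by (intro bp_inject) (auto simp:
        base_def)
    with distinct_base_bits ij show "i = j" by (simp add: nth_eq_iff_index_eq)
  qed
qed (use base_bits_nth in auto)

lemma derivative_okD:
  "derivative_ok xs mss \<Longrightarrow> ms \<in> set mss \<Longrightarrow> \<not> nonzerob (modb ms (derivb xs))
    \<Longrightarrow> \<not> nonzerob (modb ms (addb [True] xs))"
  by (induction mss) (auto split: if_splits)

lemma derivatives_okD: "derivatives_ok xss \<Longrightarrow> xs \<in> set xss \<Longrightarrow> derivative_ok xs base_bits"
  by (induction xss) auto

text \<open>This property of the list is what rules out repeated factors; it has been evaluated for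
  all 900 pairs of indices.\<close>

lemma base_dvd_pderivD:
  assumes "i < 30" "j < 30" "base j dvd pderiv (base i)"
  shows "base j dvd base i + 1"
proof -
  have "derivative_ok (base_bits ! i) base_bits" using derivatives_okD[OF derivatives_base_bits]
      assms(1) by simp
  moreover have "\<not> nonzerob (modb (base_bits ! j) (derivb (base_bits ! i)))"
    using assms base_bits_nth[of j] by (simp add: base_def bp_derivb flip: modb_dvd_iff)
  ultimately have "\<not> nonzerob (modb (base_bits ! j) (addb [True] (base_bits ! i)))"
    using derivative_okD assms(2) by (metis length_base_bits nth_mem)
  then have "bp (base_bits ! j) dvd bp (addb [True] (base_bits ! i))"
    using assms base_bits_nth[of j] by (simp add: modb_dvd_iff del: bp_addb)
  then show ?thesis by (simp add: base_def add.commute flip: one_pCons)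
qed

lemma sum_if_dvd_geo_le_dividing_degree:
  assumes "\<And>ms. ms \<in> set mss \<Longrightarrow> ms \<noteq> [] \<and> last ms \<and> tl ms \<noteq> []"
    and "\<And>ms. ms \<in> set mss \<Longrightarrow> bp ms dvd geo u (bp xs) \<Longrightarrow> dvd_any os (length ms - 1)"
  shows "(\<Sum>ms\<leftarrow>mss. if bp ms dvd geo u (bp xs) then length ms - 1 else 0) \<le> dividing_degree xs u os
      mss"
  using assms
proof (induction mss)
  case (Cons ms mss)
  have "(\<Sum>ms\<leftarrow>mss. if bp ms dvd geo u (bp xs) then length ms - 1 else 0) \<le> dividing_degree xs u os
      mss"
    using Cons by simp
  moreover have "bp ms dvd geo u (bp xs) \<longleftrightarrow> \<not> nonzerob (geomodb ms xs u)"
    using Cons.prems(1)[of ms] geomodb_dvd_iff by simp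
  moreover have "bp ms dvd geo u (bp xs) \<Longrightarrow> dvd_any os (length ms - 1)"
    using Cons.prems(2)[of ms] by simp
  ultimately show ?case by auto
qed simp

text \<open>A bound from the degrees in the list alone, without polynomial arithmetic. For large
  \<open>u\<close> it already falls below the degree of the sum.\<close>

fun compatible_degree :: "nat list \<Rightarrow> bool list list \<Rightarrow> nat" where
  "compatible_degree os [] = 0"
| "compatible_degree os (ms # mss) =
    (if dvd_any os (length ms - 1) then length ms - 1 else 0) + compatible_degree os mss"

lemma dividing_degree_le: "dividing_degree xs u os mss \<le> compatible_degree os mss"
  by (induction mss) auto

text \<open>The primes dividing \<open>2^k - 1\<close> for a degree \<open>k\<close> in the list, each with the order of 2
  modulo it.\<close>

definition orders :: "(nat \<times> nat) list" where
  "orders = [(3, 2), (5, 4), (7, 3), (13, 12), (17, 8), (31, 5), (73, 9), (127, 7)]"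

lemma prime_dvd_two_power_minus_one:
  fixes q :: nat
  assumes q: "prime q" "q dvd 2 ^ k - 1" and k: "k \<in> {1, 2, 3, 4, 5, 6, 7, 8, 9, 12}"
  shows "\<exists>(p, n)\<in>set orders. q = p \<and> n dvd k"
proof -
  have eq: "q dvd p \<longleftrightarrow> q = p" if "prime p" for p
    using that q(1) by (auto dest: primes_dvd_imp_eq)
  have "prime (3::nat)" "prime (5::nat)" "prime (7::nat)" "prime (13::nat)" "prime (17::nat)"
    "prime (31::nat)" "prime (73::nat)" "prime (127::nat)" by simp_all
  note iffs = prime_dvd_mult_iff[OF q(1)] this[THEN eq]
  from k consider "k = 1" | "k = 2" | "k = 3" | "k = 4" | "k = 5" | "k = 6" | "k = 7" | "k = 8" |
      "k = 9" | "k = 12" by auto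
  then show ?thesis
  proof cases
    case 1
    then show ?thesis using q by simp
  next
    case 2
    then have "q dvd 3" using q(2) by simp
    then show ?thesis using 2 unfolding iffs by (auto simp: orders_def)
  next
    case 3
    then have "q dvd 7" using q(2) by simp
    then show ?thesis using 3 unfolding iffs by (auto simp: orders_def)
  next
    case 4
    then have "q dvd 3 * 5" using q(2) by simp
    then show ?thesis using 4 unfolding iffs by (auto simp: orders_def)
  next
    case 5
    then have "q dvd 31" using q(2) by simp
    then show ?thesis using 5 unfolding iffs by (auto simp: orders_def)
  next
    case 6
    then have "q dvd 3 * 3 * 7" using q(2) by simp
    then show ?thesis using 6 unfolding iffs by (auto simp: orders_def)
  next
    case 7
    then have "q dvd 127" using q(2) by simp
    then show ?thesis using 7 unfolding iffs by (auto simp: orders_def)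
  next
    case 8
    then have "q dvd 3 * 5 * 17" using q(2) by simp
    then show ?thesis using 8 unfolding iffs by (auto simp: orders_def)
  next
    case 9
    then have "q dvd 7 * 73" using q(2) by simp
    then show ?thesis using 9 unfolding iffs by (auto simp: orders_def)
  next
    case 10
    then have "q dvd 3 * 3 * 5 * 7 * 13" using q(2) by simp
    then show ?thesis using 10 unfolding iffs by (auto simp: orders_def)
  qed
qed

lemma length_base_bits_nth: "i < 30 \<Longrightarrow> length (base_bits ! i) - 1 \<in> {1, 2, 3, 4, 5, 6, 7, 8, 9, 12}"
proof -
  have "\<forall>xs\<in>set base_bits. length xs - 1 \<in> {1, 2, 3, 4, 5, 6, 7, 8, 9, 12}" by (simp add:
      base_bits_def)
  then show "i < 30 \<Longrightarrow> ?thesis" by simp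
qed

lemma dvd_anyI: "n \<in> set os \<Longrightarrow> n dvd k \<Longrightarrow> dvd_any os k"
  by (induction os) auto

text \<open>A list member of degree \<open>k\<close> dividing the sum shares a prime
  \<open>q\<close> with \<open>u\<close> through \<open>2 ^ k - 1\<close>. The order of 2 modulo
  \<open>q\<close> then divides \<open>k\<close>, so the filter by \<open>os\<close> loses no
  divisor.\<close>

lemma not_geo_dvd:
  assumes i: "i < 30" and u: "odd u"
    and os: "\<forall>(q, n)\<in>set orders. q dvd u \<longrightarrow> n \<in> set os"
    and lt: "dividing_degree (base_bits ! i) u os base_bits < (u - 1) * degree (base i)"
  shows "\<not> geo u (base i) dvd (\<Prod>j<30. base j ^ e j)"
proof
  assume "geo u (base i) dvd (\<Prod>j<30. base j ^ e j)"
  then have "(u - 1) * degree (base i) \<le> (\<Sum>j<30. if base j dvd geo u (base i) then degree (base j)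
      else 0)"
    by (rule base.degree_geo_le[rotated 2]) (use i u base_dvd_pderivD in \<open>simp_all\<close>)
  also have "\<dots> = (\<Sum>j<30. if bp (base_bits ! j) dvd geo u (bp (base_bits ! i)) then length
      (base_bits ! j) - 1 else 0)"
    by (intro sum.cong refl if_cong) (simp_all add: degree_base, simp_all add: base_def)
  also have "\<dots> = (\<Sum>ms\<leftarrow>base_bits. if bp ms dvd geo u (bp (base_bits ! i)) then length ms - 1 else 0)"
    by (simp add: sum_list_sum_nth atLeast0LessThan)
  also have "\<dots> \<le> dividing_degree (base_bits ! i) u os base_bits"
  proof (rule sum_if_dvd_geo_le_dividing_degree)
    fix ms assume "ms \<in> set base_bits"
    then obtain j where j: "j < 30" "ms = base_bits ! j" by (auto simp: in_set_conv_nth)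
    then show "ms \<noteq> [] \<and> last ms \<and> tl ms \<noteq> []" using base_bits_nth by simp
    let ?k = "length ms - 1"
    assume "bp ms dvd geo u (bp (base_bits ! i))"
    moreover have "bp ms dvd X ^ (2 ^ ?k) + X" using j base_bits_nth[of j] frobenius_trivialb by
        simp
    moreover have "irreducible (bp ms)" using j base_bits_nth[of j] by (simp add: base_def)
    ultimately have "\<not> coprime u (2 ^ ?k - 1)" using dvd_geo_imp_not_coprime u by blast
    then have "gcd u (2 ^ ?k - 1) \<noteq> 1" by (simp add: coprime_iff_gcd_eq_1)
    then obtain q where "prime q" "q dvd gcd u (2 ^ ?k - 1)" using prime_factor_nat by blast
    then have q: "prime q" "q dvd u" "q dvd 2 ^ ?k - 1" by (auto dest: gcd_nat.boundedE)
    have "?k \<in> {1, 2, 3, 4, 5, 6, 7, 8, 9, 12}" using length_base_bits_nth[OF j(1)] j(2) by simp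
    from prime_dvd_two_power_minus_one[OF q(1,3) this]
    obtain n where n: "(q, n) \<in> set orders" "n dvd ?k" by blast
    then have "n \<in> set os" using os q(2) by blast
    then show "dvd_any os ?k" using n(2) by (rule dvd_anyI)
  qed
  finally show False using lt by simp
qed

lemma excludedD:
  assumes "excluded u os is" "i \<in> set is" "i < 30" "odd u"
    and "\<forall>(q, n)\<in>set orders. q dvd u \<longrightarrow> n \<in> set os"
  shows "\<not> geo u (base i) dvd (\<Prod>j<30. base j ^ e j)"
proof -
  have "dividing_degree (base_bits ! i) u os base_bits < (u - 1) * (length (base_bits ! i) - 1)"
    using assms(1,2) by (induction "is") auto
  then show ?thesis using assms degree_base by (intro not_geo_dvd) auto
qed

lemma compatible_degreeD:
  assumes "compatible_degree os base_bits < (u - 1) * degree (base i)" "i < 30" "odd u"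
    and "\<forall>(q, n)\<in>set orders. q dvd u \<longrightarrow> n \<in> set os"
  shows "\<not> geo u (base i) dvd (\<Prod>j<30. base j ^ e j)"
  using assms dividing_degree_le[of "base_bits ! i" u os base_bits] by (intro not_geo_dvd) auto

lemma compatible_degree_Nil: "compatible_degree [] mss = 0"
  by (induction mss) auto

lemma compatible_degree_base_bits:
  "compatible_degree [12] base_bits = 36" "compatible_degree [8] base_bits = 16"
      "compatible_degree [5] base_bits = 20"
  "compatible_degree [9] base_bits = 18" "compatible_degree [7] base_bits = 56" "compatible_degree
      [3, 12] base_bits = 78"
  by code_simp+

definition admissible :: "nat \<Rightarrow> nat \<Rightarrow> bool" where
  "admissible i u \<longleftrightarrow> u = 1 \<or> map_of fac_geo (i, u) \<noteq> None"

text \<open>The ten forbidden divisors are exactly the minimal products of 3, 5, 7 and 13 outside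
  the final set.\<close>

lemma odd_cofactor_cases:
  fixes u :: nat
  assumes "odd u" and pr: "\<And>q. prime q \<Longrightarrow> q dvd u \<Longrightarrow> q \<in> {3, 5, 7, 13}"
    and nd: "\<not> 21 dvd u" "\<not> 25 dvd u" "\<not> 27 dvd u" "\<not> 35 dvd u" "\<not> 39 dvd u" "\<not> 45 dvd u"
      "\<not> 49 dvd u" "\<not> 65 dvd u" "\<not> 91 dvd u" "\<not> 169 dvd u"
  shows "u \<in> {1, 3, 5, 7, 9, 13, 15}"
proof -
  have one: "v = 1" if "v dvd u" "\<not> 3 dvd v" "\<not> 5 dvd v" "\<not> 7 dvd v" "\<not> 13 dvd v" for v
  proof (rule ccontr)
    assume "v \<noteq> 1"
    then obtain q where "prime q" "q dvd v" using prime_factor_nat by blast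
    with pr[of q] that show False by auto
  qed
  consider "13 dvd u" | "7 dvd u" | "5 dvd u" "\<not> 7 dvd u" "\<not> 13 dvd u"
    | "3 dvd u" "\<not> 5 dvd u" "\<not> 7 dvd u" "\<not> 13 dvd u"
    | "\<not> 3 dvd u" "\<not> 5 dvd u" "\<not> 7 dvd u" "\<not> 13 dvd u" by blast
  then show ?thesis
  proof cases
    case 1
    then obtain v where v: "u = 13 * v" by auto
    have "v = 1" using nd by (intro one) (auto simp: v)
    with v show ?thesis by simp
  next
    case 2
    then obtain v where v: "u = 7 * v" by auto
    have "v = 1" using nd by (intro one) (auto simp: v)
    with v show ?thesis by simp
  next
    case 3
    then obtain v where v: "u = 5 * v" by auto
    show ?thesis
    proof (cases "3 dvd v")
      case True
      then obtain w where w: "v = 3 * w" by auto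
      have "w = 1" using nd 3 by (intro one) (auto simp: v w)
      with v w show ?thesis by simp
    next
      case False
      have "v = 1" using nd 3 False by (intro one) (auto simp: v)
      with v show ?thesis by simp
    qed
  next
    case 4
    then obtain v where v: "u = 3 * v" by auto
    show ?thesis
    proof (cases "3 dvd v")
      case True
      then obtain w where w: "v = 3 * w" by auto
      have "w = 1" using nd 4 by (intro one) (auto simp: v w)
      with v w show ?thesis by simp
    next
      case False
      have "v = 1" using 4 False by (intro one) (auto simp: v)
      with v show ?thesis by simp
    qed
  next
    case 5
    then show ?thesis using one[of u] by simp
  qed
qed

lemma degree_base_ge: "2 \<le> i \<Longrightarrow> i < 30 \<Longrightarrow> 2 \<le> degree (base i)" "5 \<le> i \<Longrightarrow> i < 30 \<Longrightarrow> 4 \<le> degree (base i)"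
proof -
  have "\<forall>xs\<in>set (drop 2 base_bits). 2 \<le> length xs - 1" "\<forall>xs\<in>set (drop 5 base_bits). 4 \<le> length xs
      - 1"
    by (simp_all add: base_bits_def)
  then have *: "\<forall>n<28. 2 \<le> length (drop 2 base_bits ! n) - 1" "\<forall>n<25. 4 \<le> length (drop 5 base_bits
      ! n) - 1"
    by (simp_all add: all_set_conv_all_nth)
  show "2 \<le> i \<Longrightarrow> i < 30 \<Longrightarrow> 2 \<le> degree (base i)"
    using *(1)[rule_format, of "i - 2"] by (simp add: degree_base Suc_diff_Suc numeral_2_eq_2)
  show "5 \<le> i \<Longrightarrow> i < 30 \<Longrightarrow> 4 \<le> degree (base i)"
    using *(2)[rule_format, of "i - 5"] by (simp add: degree_base)
qed

lemma admissible_table: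
  "\<forall>u\<in>{1, 3, 5, 7, 9, 13, 15}. admissible 0 u \<and> admissible 1 u"
  "\<forall>u\<in>{1, 3, 5, 7, 15}. admissible 2 u"
  "\<forall>i\<in>{3, 4, 15, 16}. admissible i 3"
  "admissible i 1"
  by (simp_all add: admissible_def fac_geo_def)

lemma odd_cofactor_admissible:
  assumes i: "i < 30" and u: "odd u" and dvd: "geo u (base i) dvd (\<Prod>j<30. base j ^ e j)"
  shows "admissible i u"
proof -
  have P1: "base i \<noteq> 1" using base.P_neq_1 i by simp
  have geo_dvd: "geo d (base i) dvd (\<Prod>j<30. base j ^ e j)" if "d dvd u" for d
    using geo_dvd_geo[OF P1 that] dvd dvd_trans by blast
  have excl: "\<not> d dvd u" if "excluded d os is" "i \<in> set is" "odd d"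
    "\<forall>(q, n)\<in>set orders. q dvd d \<longrightarrow> n \<in> set os" for d os "is"
    using excludedD[OF that(1,2) i that(3,4)] geo_dvd by blast
  have comp: "\<not> d dvd u" if "compatible_degree os base_bits < (d - 1) * degree (base i)" "odd d"
    "\<forall>(q, n)\<in>set orders. q dvd d \<longrightarrow> n \<in> set os" for d os
    using compatible_degreeD[OF that(1) i that(2,3)] geo_dvd by blast
  have deg: "degree (base i) > 0" using base.degree_P_pos i by simp
  have n17: "\<not> 17 dvd u"
  proof (cases "i < 2")
    case True
    then show ?thesis by (intro excl[OF excluded_17]) (auto simp: orders_def)
  next
    case False
    then have "2 \<le> degree (base i)" using degree_base_ge(1) i by simp
    then show ?thesis by (intro comp[of "[8]"]) (auto simp: orders_def compatible_degree_base_bits)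
  qed
  have n31: "\<not> 31 dvd u" using deg by (intro comp[of "[5]"]) (auto simp: orders_def
      compatible_degree_base_bits)
  have n73: "\<not> 73 dvd u" using deg by (intro comp[of "[9]"]) (auto simp: orders_def
      compatible_degree_base_bits)
  have n127: "\<not> 127 dvd u" using deg by (intro comp[of "[7]"]) (auto simp: orders_def
      compatible_degree_base_bits)
  have n91: "\<not> 91 dvd u" using deg by (intro comp[of "[3, 12]"]) (auto simp: orders_def
      compatible_degree_base_bits)
  have n169: "\<not> 169 dvd u" using deg by (intro comp[of "[12]"]) (auto simp: orders_def
      compatible_degree_base_bits)
  have n5: "\<not> 5 dvd u" and n7: "\<not> 7 dvd u" if "3 \<le> i"
  proof -
    have "i \<in> set [3..<30]" using that i by (simp only: set_upt atLeastLessThan_iff)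
    then show "\<not> 5 dvd u" "\<not> 7 dvd u"
      by (rule excl[OF excluded_5] excl[OF excluded_7]; simp add: orders_def)+
  qed
  have n13: "\<not> 13 dvd u" if "2 \<le> i"
  proof (cases "i < 5")
    case True
    then show ?thesis using that by (intro excl[OF excluded_13]) (auto simp: orders_def)
  next
    case False
    then have "4 \<le> degree (base i)" using degree_base_ge(2) i by simp
    then show ?thesis by (intro comp[of "[12]"]) (auto simp: orders_def compatible_degree_base_bits)
  qed
  have n3: "\<not> 3 dvd u" if "5 \<le> i" "i \<noteq> 15" "i \<noteq> 16"
  proof -
    have "i \<in> set ([5..<15] @ [17..<30])"
      using that i by (simp only: set_append set_upt atLeastLessThan_iff Un_iff) arith
    then show ?thesis by (rule excl[OF excluded_3]) (simp_all add: orders_def)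
  qed
  have n9: "\<not> 9 dvd u" if "i \<in> {2, 3, 4, 15, 16}"
    using that by (intro excl[OF excluded_9]) (auto simp: orders_def)
  have n21: "\<not> 21 dvd u" "\<not> 25 dvd u" "\<not> 35 dvd u" "\<not> 49 dvd u"
  proof -
    have "\<not> 21 dvd u \<and> \<not> 25 dvd u \<and> \<not> 35 dvd u \<and> \<not> 49 dvd u"
    proof (cases "i \<le> 2")
      case True
      then have "i \<in> set [0, 1, 2]" by auto
      then show ?thesis
        by (intro conjI excl[OF excluded_21] excl[OF excluded_25] excl[OF excluded_35]
            excl[OF excluded_49]) (auto simp: orders_def)
    next
      case False
      then show ?thesis using n5 n7 by (auto dest: dvd_trans[of 7 21] dvd_trans[of 5 25]
          dvd_trans[of 5 35] dvd_trans[of 7 49])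
    qed
    then show "\<not> 21 dvd u" "\<not> 25 dvd u" "\<not> 35 dvd u" "\<not> 49 dvd u" by auto
  qed
  have n27: "\<not> 27 dvd u" "\<not> 39 dvd u" "\<not> 45 dvd u" "\<not> 65 dvd u"
  proof -
    have "\<not> 27 dvd u \<and> \<not> 39 dvd u \<and> \<not> 45 dvd u \<and> \<not> 65 dvd u"
    proof (cases "i \<le> 1")
      case True
      then have "i \<in> set [0, 1]" by auto
      then show ?thesis
        by (intro conjI excl[OF excluded_27] excl[OF excluded_39] excl[OF excluded_45]
            excl[OF excluded_65]) (auto simp: orders_def)
    next
      case False
      have 9: "\<not> 9 dvd u"
      proof (cases "i \<in> {2, 3, 4, 15, 16}")
        case False
        with \<open>\<not> i \<le> 1\<close> have "\<not> 3 dvd u" by (intro n3) auto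
        then show ?thesis by (auto dest: dvd_trans[of 3 9])
      qed (fact n9)
      from False n13 have "\<not> 13 dvd u" by simp
      then show ?thesis using 9
        by (auto dest: dvd_trans[of 9 27] dvd_trans[of 13 39] dvd_trans[of 9 45] dvd_trans[of 13
            65])
    qed
    then show "\<not> 27 dvd u" "\<not> 39 dvd u" "\<not> 45 dvd u" "\<not> 65 dvd u" by auto
  qed
  have pr: "q \<in> {3, 5, 7, 13}" if q: "prime q" "q dvd u" for q
  proof (rule ccontr)
    assume "q \<notin> {3, 5, 7, 13}"
    with q n17 n31 n73 n127 have neq: "q \<notin> fst ` set orders" by (auto simp: orders_def)
    have "\<not> p dvd q" if "p \<in> fst ` set orders" for p
    proof -
      have "prime p" using that by (auto simp: orders_def)
      then show ?thesis using q(1) neq that primes_dvd_imp_eq by blast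
    qed
    moreover have "odd q" using q(2) u by (meson dvd_trans)
    moreover have "q > 1" using q(1) by (rule prime_gt_1_nat)
    \<comment> \<open>No list member can divide the sum for such a \<open>q\<close>: with the empty
      list of orders the degree bound is zero.\<close>
    ultimately have "\<not> q dvd u"
      using deg by (intro comp[of "[]"]) (auto simp: compatible_degree_Nil rev_image_eqI)
    with q(2) show False by simp
  qed
  have u_cases: "u \<in> {1, 3, 5, 7, 9, 13, 15}"
    by (rule odd_cofactor_cases[OF u pr n21(1,2) n27(1) n21(3) n27(2,3) n21(4) n27(4) n91 n169])
  have "i = 0 \<or> i = 1 \<or> i = 2 \<or> i = 3 \<or> i = 4 \<or> 5 \<le> i" by linarith
  then consider "i = 0" | "i = 1" | "i = 2" | "i \<in> {3, 4, 15, 16}" | "5 \<le> i" "i \<noteq> 15" "i \<noteq> 16"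
    by blast
  then show ?thesis
  proof cases
    case 1
    then show ?thesis using u_cases admissible_table(1) by blast
  next
    case 2
    then show ?thesis using u_cases admissible_table(1) by blast
  next
    case 3
    then have "\<not> 13 dvd u" "\<not> 9 dvd u" using n13 n9 by simp_all
    then have "u \<noteq> 13" "u \<noteq> 9" by auto
    then have "u \<in> {1, 3, 5, 7, 15}" using u_cases by blast
    then show ?thesis using 3 admissible_table(2) by blast
  next
    case 4
    then have "\<not> 5 dvd u" "\<not> 7 dvd u" "\<not> 13 dvd u" "\<not> 9 dvd u" using n5 n7 n13 n9 by auto
    then have "u \<noteq> 5" "u \<noteq> 7" "u \<noteq> 13" "u \<noteq> 9" "u \<noteq> 15" by auto
    then have "u = 1 \<or> u = 3" using u_cases by blast
    then show ?thesis using 4 admissible_table(3,4) by blast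
  next
    case 5
    then have "\<not> 5 dvd u" "\<not> 7 dvd u" "\<not> 13 dvd u" "\<not> 3 dvd u" using n5 n7 n13 n3 by auto
    then have "u \<noteq> 5" "u \<noteq> 7" "u \<noteq> 13" "u \<noteq> 3" "u \<noteq> 9" "u \<noteq> 15" by auto
    then have "u = 1" using u_cases by blast
    then show ?thesis using admissible_table(4) by blast
  qed
qed

section \<open>From the factor tables to multiplicities\<close>

lemma bp_prodb: "bp (prodb l) = prod_list (map base l)"
  by (induction l) (auto simp: base_def simp flip: one_pCons)

lemma bp_geob: "bp (geob xs n) = geo n (bp xs)"
  by (induction n) (auto simp: geo_Suc simp flip: one_pCons)

lemma bp_eqI: "\<not> nonzerob (addb xs ys) \<Longrightarrow> bp xs = bp ys"
  by (metis add.right_neutral bp_addb bp_eq_0_iff poly_bit_add_self poly_bit_add_self_left)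

lemma check_fac_succD:
  "check_fac_succ xss ls \<Longrightarrow> i < length xss \<Longrightarrow> 1 + bp (xss ! i) = prod_list (map base (ls ! i))"
proof (induction xss ls arbitrary: i rule: check_fac_succ.induct)
  case (1 xs xss l ls)
  then have "bp (addb [True] xs) = bp (prodb l)" by (intro bp_eqI) simp
  then have "1 + bp xs = prod_list (map base l)" by (simp add: bp_prodb flip: one_pCons)
  with 1 show ?case by (cases i) auto
qed auto

lemma check_fac_geoD:
  "check_fac_geo fs \<Longrightarrow> ((i, u), l) \<in> set fs \<Longrightarrow> geo u (base i) = prod_list (map base l)"
proof (induction fs rule: check_fac_geo.induct)
  case (2 i' u' l' fs)
  then have "bp (geob (base_bits ! i') u') = bp (prodb l')" by (intro bp_eqI) simp
  then have "geo u' (base i') = prod_list (map base l')" by (simp add: bp_prodb bp_geob base_def)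
  with 2 show ?case by auto
qed simp

lemma base_plus_1: "i < 30 \<Longrightarrow> base i + 1 = prod_list (map base (fac_succ ! i))"
  using check_fac_succD[OF fac_succ_correct, of i] by (simp add: base_def add.commute)

text \<open>The default \<open>[]\<close> is the factorisation for \<open>u = 1\<close>, where the
  sum is the empty product; the other pairs outside the table are not admissible.\<close>

definition factors :: "nat \<Rightarrow> nat \<Rightarrow> nat list" where
  "factors i u = (case map_of fac_geo (i, u) of None \<Rightarrow> [] | Some l \<Rightarrow> l)"

lemma geo_base:
  assumes "admissible i u" shows "geo u (base i) = prod_list (map base (factors i u))"
proof (cases "map_of fac_geo (i, u)")
  case None
  with assms show ?thesis by (simp add: admissible_def factors_def)
next
  case (Some l)
  then show ?thesis
    using check_fac_geoD[OF fac_geo_correct map_of_SomeD[OF Some]] by (simp add: factors_def)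
qed

lemma prod_list_base:
  "set l \<subseteq> {..<30} \<Longrightarrow> prod_list (map base l) = (\<Prod>j<30. base j ^ count_list l j)"
proof (induction l)
  case (Cons a l)
  have "(\<Prod>j<30. base j ^ count_list (a # l) j)
      = (\<Prod>j<30. (if j = a then base j else 1) * base j ^ count_list l j)"
    by (intro prod.cong) auto
  also have "\<dots> = base a * (\<Prod>j<30. base j ^ count_list l j)"
    using Cons.prems by (simp add: prod.distrib)
  finally show ?case using Cons by simp
qed simp

lemma set_fac_succ: "i < 30 \<Longrightarrow> set (fac_succ ! i) \<subseteq> {..<30}"
proof -
  have "length fac_succ = 30" "\<forall>l\<in>set fac_succ. set l \<subseteq> {..<30}" by (simp_all add: fac_succ_def)
  then show "i < 30 \<Longrightarrow> ?thesis" by simp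
qed

lemma set_factors: "set (factors i u) \<subseteq> {..<30}"
proof -
  have "\<forall>(_, l)\<in>set fac_geo. set l \<subseteq> {..<30}" by (simp add: fac_geo_def)
  then show ?thesis by (cases "map_of fac_geo (i, u)") (auto simp: factors_def dest!: map_of_SomeD)
qed

text \<open>The multiplicity of \<open>base j\<close> in the divisor sum of a product with exponents
  \<open>2 ^ h i * u i - 1\<close>.\<close>

definition weight :: "(nat \<Rightarrow> nat) \<Rightarrow> (nat \<Rightarrow> nat) \<Rightarrow> nat \<Rightarrow> nat" where
  "weight h u j = (\<Sum>i<30. (2 ^ h i - 1) * count_list (fac_succ ! i) j
     + 2 ^ h i * count_list (factors i (u i)) j)"

text \<open>Serves in both directions: to extract the exponent system from a perfect product, and to
  verify the eleven solutions.\<close>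

lemma perfect_prod_base_iff:
  assumes e: "\<And>i. i < 30 \<Longrightarrow> Suc (e i) = 2 ^ h i * u i \<and> admissible i (u i)"
  shows "perfect (\<Prod>i<30. base i ^ e i) \<longleftrightarrow> (\<forall>j<30. e j = weight h u j)"
proof -
  have "(\<Sum>k<Suc (e i). base i ^ k) = (\<Prod>j<30. base j ^ ((2 ^ h i - 1) * count_list (fac_succ ! i) j
     + 2 ^ h i * count_list (factors i (u i)) j))" if i: "i < 30" for i
  proof -
    have "(\<Sum>k<Suc (e i). base i ^ k) = geo (2 ^ h i * u i) (base i)" using e[OF i] by (simp add:
        geo_def)
    also have "\<dots> = (base i + 1) ^ (2 ^ h i - 1) * geo (u i) (base i) ^ (2 ^ h i)"
      using base.P_neq_1 i by (simp add: geo_two_power_mult)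
    also have "base i + 1 = (\<Prod>j<30. base j ^ count_list (fac_succ ! i) j)"
      using base_plus_1[OF i] prod_list_base[OF set_fac_succ[OF i]] by simp
    also have "geo (u i) (base i) = (\<Prod>j<30. base j ^ count_list (factors i (u i)) j)"
      using geo_base e[OF i] prod_list_base[OF set_factors] by simp
    finally show ?thesis
      by (simp add: prod_power_distrib power_add prod.distrib mult.commute flip: power_mult)
  qed
  then have "sigma (\<Prod>i<30. base i ^ e i) = (\<Prod>i<30. \<Prod>j<30. base j ^ ((2 ^ h i - 1) * count_list
      (fac_succ ! i) j
     + 2 ^ h i * count_list (factors i (u i)) j))"
    by (simp add: base.sigma_prod_P)
  also have "\<dots> = (\<Prod>j<30. base j ^ weight h u j)"
    by (subst prod.swap) (simp add: weight_def power_sum)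
  finally have "sigma (\<Prod>i<30. base i ^ e i) = (\<Prod>j<30. base j ^ weight h u j)" .
  then have "perfect (\<Prod>i<30. base i ^ e i)
      \<longleftrightarrow> (\<Prod>j<30. base j ^ weight h u j) = (\<Prod>j<30. base j ^ e j)"
    using base.P_neq_0 by (simp add: perfect_def)
  also have "\<dots> \<longleftrightarrow> (\<forall>j<30. e j = weight h u j)" by (subst base.prod_P_inject) auto
  finally show ?thesis .
qed

lemma two_power_mult_odd:
  fixes n :: nat
  assumes "n > 0" obtains h u where "n = 2 ^ h * u" "odd u"
proof -
  have "\<exists>h u. n = 2 ^ h * u \<and> odd u" using assms
  proof (induction n rule: less_induct)
    case (less n)
    show ?case
    proof (cases "even n")
      case True
      then obtain m where m: "n = 2 * m" by blast
      with less.prems have "m < n" "m > 0" by auto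
      from less.IH[OF this] obtain h u where "m = 2 ^ h * u" "odd u" by blast
      with m show ?thesis by (intro exI[of _ "Suc h"] exI[of _ u]) simp
    next
      case False
      then show ?thesis by (intro exI[of _ 0] exI[of _ n]) simp
    qed
  qed
  with that show ?thesis by blast
qed

lemma perfect_prod_baseD:
  assumes "perfect (\<Prod>i<30. base i ^ e i)"
  obtains h u where "\<And>i. i < 30 \<Longrightarrow> Suc (e i) = 2 ^ h i * u i"
    "\<And>i. i < 30 \<Longrightarrow> admissible i (u i)" "\<And>j. j < 30 \<Longrightarrow> e j = weight h u j"
proof -
  have "\<forall>i. \<exists>h u. Suc (e i) = 2 ^ h * u \<and> odd u" using two_power_mult_odd by (metis zero_less_Suc)
  then obtain h u where hu: "\<And>i. Suc (e i) = 2 ^ h i * u i" "\<And>i. odd (u i)" by metis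
  have adm: "admissible i (u i)" if i: "i < 30" for i
  proof (rule odd_cofactor_admissible[OF i hu(2)])
    have "geo (u i) (base i) dvd geo (Suc (e i)) (base i)"
      using base.P_neq_1 i hu(1)[of i] by (intro geo_dvd_geo) auto
    also have "\<dots> dvd (\<Prod>i<30. geo (Suc (e i)) (base i))" using i by (intro dvd_prodI) auto
    also have "\<dots> = (\<Prod>i<30. base i ^ e i)"
      using assms base.sigma_prod_P[of e] by (simp add: perfect_def geo_def)
    finally show "geo (u i) (base i) dvd (\<Prod>j<30. base j ^ e j)" .
  qed
  with assms hu have "\<forall>j<30. e j = weight h u j"
    by (subst (asm) perfect_prod_base_iff[of e h u]) auto
  then show ?thesis using that[OF hu(1) adm] by blast
qed

section \<open>The exponent system\<close>

definition pow2 :: "int \<Rightarrow> bool" where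
  "pow2 n \<longleftrightarrow> (\<exists>h. n = 2 ^ h)"

lemma pow2_ge_1: "pow2 n \<Longrightarrow> 1 \<le> n"
  by (auto simp: pow2_def)

lemma pow2_dvd: "pow2 a \<Longrightarrow> pow2 b \<Longrightarrow> a \<le> b \<Longrightarrow> a dvd b"
  by (auto simp: pow2_def le_imp_power_dvd)

lemma pow2_cases:
  assumes "pow2 n" "n < 2048"
  shows "n \<in> {1, 2, 4, 8, 16, 32, 64, 128, 256, 512, 1024}"
proof -
  obtain h where h: "n = 2 ^ h" using assms(1) by (auto simp: pow2_def)
  have "(2::int) ^ h < 2 ^ 11" using assms(2) h by simp
  then have "h < 11" by (rule power_less_imp_less_exp[rotated]) simp
  then have "h = 0 \<or> h = 1 \<or> h = 2 \<or> h = 3 \<or> h = 4 \<or> h = 5 \<or> h = 6 \<or> h = 7 \<or> h = 8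
    \<or> h = 9 \<or> h = 10" by presburger
  then show ?thesis unfolding h by (elim disjE) simp_all
qed

text \<open>If all summands exceed the current partial sum \<open>c\<close>, they are multiples of a power of two
  larger than \<open>c\<close>, so the 2-part of the total divides \<open>c\<close>. Hence the partial sums, taken in
  increasing order, grow by a factor of at most \<open>max 2 u\<close>.\<close>

lemma sum_pow2_le:
  fixes c u q :: int
  assumes "\<forall>t\<in>set ts. t = 0 \<or> pow2 t" "1 \<le> c" "c + sum_list ts = q * u" "pow2 q" "1 \<le> u"
  shows "q * u \<le> (max 2 u) ^ length ts * c"
  using assms(1-3)
proof (induction "length ts" arbitrary: ts c)
  case 0
  then show ?case by simp
next
  case (Suc n)
  let ?K = "max 2 u" and ?t = "Min (set ts)"
  have K: "1 \<le> ?K ^ n" by (rule one_le_power) simp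
  have ne: "ts \<noteq> []" using Suc.hyps(2) by auto
  then have t: "?t \<in> set ts" by simp
  show ?case
  proof (cases "?t \<le> c")
    case True
    have "q * u \<le> ?K ^ length (remove1 ?t ts) * (c + ?t)"
    proof (rule Suc.hyps(1))
      show "n = length (remove1 ?t ts)" using t Suc.hyps(2) by (simp add: length_remove1)
      show "\<forall>t\<in>set (remove1 ?t ts). t = 0 \<or> pow2 t"
        using Suc.prems(1) set_remove1_subset by fast
      have "0 \<le> ?t" using t Suc.prems(1) pow2_ge_1 by fastforce
      then show "1 \<le> c + ?t" using Suc.prems(2) by simp
      have "sum_list ts = ?t + sum_list (remove1 ?t ts)" using t by (rule sum_list_map_remove1[of
          _ _ id, simplified])
      then show "c + ?t + sum_list (remove1 ?t ts) = q * u" using Suc.prems(3) by simp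
    qed
    also have "length (remove1 ?t ts) = n" using t Suc.hyps(2) by (simp add: length_remove1)
    also have "?K ^ n * (c + ?t) \<le> ?K ^ n * (?K * c)"
    proof (rule mult_left_mono)
      have "c + ?t \<le> 2 * c" using True by simp
      also have "\<dots> \<le> ?K * c" using Suc.prems(2) by (intro mult_right_mono) auto
      finally show "c + ?t \<le> ?K * c" .
    qed (use K in simp)
    finally show ?thesis using Suc.hyps(2)[symmetric] by (simp add: mult.assoc mult.left_commute)
  next
    case False
    have pos: "pow2 s \<and> ?t \<le> s" if "s \<in> set ts" for s
    proof -
      have "?t \<le> s" using that by simp
      moreover have "s \<noteq> 0" using calculation False Suc.prems(2) by linarith
      ultimately show ?thesis using that Suc.prems(1) by blast
    qed
    have tp: "pow2 ?t" using pos[OF t] by blast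
    have "?t dvd s" if "s \<in> set ts" for s using pow2_dvd[OF tp] pos[OF that] by blast
    moreover have "k dvd sum_list us" if "\<forall>s\<in>set us. k dvd s" for k :: int and us
      using that by (induction us) auto
    ultimately have d: "?t dvd sum_list ts" by blast
    have "\<not> ?t \<le> q"
    proof
      assume "?t \<le> q"
      then have "?t dvd c + sum_list ts" using pow2_dvd[OF tp assms(4)] Suc.prems(3) by simp
      then have "?t dvd c" using d by (simp add: dvd_add_left_iff)
      then show False using False Suc.prems(2) zdvd_imp_le[of ?t c] by linarith
    qed
    then have "q dvd ?t" using pow2_dvd[OF assms(4) tp] by linarith
    then have "q dvd sum_list ts" using d dvd_trans by blast
    moreover have "q dvd c + sum_list ts" using Suc.prems(3) by simp
    ultimately have "q dvd c" by (simp add: dvd_add_left_iff)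
    then have "q \<le> c" using Suc.prems(2) zdvd_imp_le by auto
    then have "q * u \<le> ?K * c"
      using assms(5) Suc.prems(2) by (subst mult.commute) (intro mult_mono, auto)
    also have "?K * c \<le> ?K ^ length ts * c"
    proof (rule mult_right_mono)
      show "?K \<le> ?K ^ length ts"
        using mult_left_mono[OF K, of ?K] Suc.hyps(2)[symmetric] by simp
    qed (use Suc.prems(2) in simp)
    finally show ?thesis .
  qed
qed

definition on :: "bool \<Rightarrow> int \<Rightarrow> int" where "on b x = (if b then x else 0)"

text \<open>\<open>(n, q, u)\<close> with \<open>n = q u\<close>, \<open>q\<close> a power of two and \<open>u \<in> {1, 3}\<close>.\<close>

definition split_table :: "(int \<times> int \<times> int) list" where
  "split_table = [(1, 1, 1), (2, 2, 1), (3, 1, 3), (4, 4, 1), (6, 2, 3), (8, 8, 1), (12, 4, 3),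
    (16, 16, 1), (24, 8, 3), (32, 32, 1), (48, 16, 3), (64, 64, 1)]"

definition power_table :: "(int \<times> int) list" where
  "power_table = [(1, 1), (2, 2), (4, 4), (8, 8), (16, 16), (32, 32)]"

text \<open>In the exponent system \<open>x\<close>, \<open>y\<close>, \<open>m\<close>, \<open>p\<close>, \<open>r\<close>, \<open>t\<close>, \<open>s\<^sub>j\<close> are the 2-parts of \<open>e + 1\<close> for
  the exponents \<open>e\<close> of \<open>x\<close>, \<open>x + 1\<close>, \<open>M\<^sub>1\<close>, \<open>M\<^sub>2\<close> (equal to that of \<open>M\<^sub>3\<close>), \<open>M\<^sub>4\<close>, \<open>M\<^sub>5\<close>, \<open>S\<^sub>j\<close>,
  and \<open>ux\<close>, \<open>uy\<close>, \<open>um\<close>, \<open>up\<close>, \<open>u\<^sub>1\<close>, \<open>u\<^sub>2\<close> the odd parts. The first three pairs determine all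
  other unknowns, and only the equations of \<open>x\<close>, \<open>x + 1\<close> and \<open>M\<^sub>1\<close> remain; \<open>constants\<close> returns
  their constant terms.\<close>

definition constants :: "int \<Rightarrow> int \<Rightarrow> int \<Rightarrow> int \<Rightarrow> int \<Rightarrow> int \<Rightarrow> (int \<times> int \<times> int) option" where
  "constants ux x uy y um m =
    (case map_of split_table (1 + on (ux = 7) x + on (uy = 7) y + on (um = 7) m) of None \<Rightarrow> None
     | Some (p, up) \<Rightarrow>
     (case map_of power_table (1 + on (ux = 13) x) of None \<Rightarrow> None | Some s3 \<Rightarrow>
     (case map_of power_table (1 + on (ux = 9) x) of None \<Rightarrow> None | Some s4 \<Rightarrow>
     (case map_of power_table (1 + on (uy = 9) y) of None \<Rightarrow> None | Some s5 \<Rightarrow>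
     (case map_of power_table (1 + on (uy = 13) y) of None \<Rightarrow> None | Some s6 \<Rightarrow>
     (case map_of power_table (1 + on (um = 5 \<or> um = 15) m) of None \<Rightarrow> None | Some s8 \<Rightarrow>
     (case map_of split_table (1 + on (um = 7) m) of None \<Rightarrow> None | Some (s2, u2) \<Rightarrow>
     (case map_of power_table (1 + on (um = 15) m + on (u2 = 3) s2) of None \<Rightarrow> None | Some s7 \<Rightarrow>
     (case map_of split_table (1 + on (ux = 15) x + on (uy = 15) y + on (um = 3 \<or> um = 15) m
        + on (u2 = 3) s2) of None \<Rightarrow> None | Some (s1, u1) \<Rightarrow>
     (case map_of power_table (1 + on (ux = 5 \<or> ux = 15) x + on (uy = 15) y + on (um = 15) m
        + on (up = 3) p + on (u1 = 3) s1) of None \<Rightarrow> None | Some r \<Rightarrow>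
     (case map_of power_table (1 + on (uy = 5 \<or> uy = 15) y + on (ux = 15) x + on (um = 15) m
        + on (up = 3) p + on (u1 = 3) s1) of None \<Rightarrow> None | Some t \<Rightarrow>
      Some
       (3 * p + r + 3 * t + s1 + 2 * s2 + s3 + 3 * s4 + s5 + 3 * s6 + s7 + 3 * s8 - 23,
        3 * p + 3 * r + t + s1 + 2 * s2 + 3 * s3 + s4 + 3 * s5 + s6 + s7 + 3 * s8 - 23,
        2 * on (up = 3) p + s1 + s2 + 4 * s3 + s4 + s5 + 4 * s6 + 3 * s7 + s8 - 15))))))))))))"

text \<open>Tuples \<open>(ux, x, uy, y, um, m)\<close> in the order of \<open>T\<close>. The first
  gives the exponents 3 * 1 - 1, 1 * 2 - 1 and 1 * 2 - 1 of \<open>x\<close>, \<open>x + 1\<close>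
  and \<open>M 1\<close>.\<close>

definition solution_table :: "(int \<times> int \<times> int \<times> int \<times> int \<times> int) list" where
  "solution_table = [(3, 1, 1, 2, 1, 2), (1, 2, 3, 1, 1, 2), (5, 1, 1, 4, 1, 1), (1, 4, 5, 1, 1, 1),
     (5, 1, 5, 1, 1, 1), (7, 1, 1, 4, 1, 1), (1, 4, 7, 1, 1, 1), (5, 1, 7, 1, 1, 1),
     (7, 1, 5, 1, 1, 1), (3, 1, 1, 2, 3, 1), (1, 2, 3, 1, 3, 1)]"

definition solved where
  "solved ux x uy y um m cx cy cm =
    (if x * ux = y + m + cx then
       (if y * uy = x + m + cy then
          (if m * um = cm + on (ux \<in> {3, 9, 15}) x + on (uy \<in> {3, 9, 15}) y then
             (ux, x, uy, y, um, m) \<in> set solution_table else True) else True) else True)"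

definition powers :: "int list" where "powers = [1, 2, 4, 8, 16, 32, 64, 128, 256, 512, 1024]"

fun solved_m where
  "solved_m ux x uy y um cx cy cm [] = True"
| "solved_m ux x uy y um cx cy cm (m # ms) = (solved ux x uy y um m cx cy cm \<and> solved_m ux x uy y
    um cx cy cm ms)"

fun solved_y where
  "solved_y ux x uy um cx cy cm ms [] = True"
| "solved_y ux x uy um cx cy cm ms (y # ys) = (solved_m ux x uy y um cx cy cm ms \<and> solved_y ux x
    uy um cx cy cm ms ys)"

fun solved_x where
  "solved_x ux uy um cx cy cm ms ys [] = True"
| "solved_x ux uy um cx cy cm ms ys (x # xs) = (solved_y ux x uy um cx cy cm ms ys \<and> solved_x ux
    uy um cx cy cm ms ys xs)"

text \<open>The value 0 stands for a 2-part that does not enter \<open>constants\<close>, and is then enumerated.\<close>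

definition powers_or where "powers_or v = (if v = 0 then powers else [v])"

fun checked_m where
  "checked_m ux x uy y [] = True"
| "checked_m ux x uy y ((um, m) # m_candidates) =
    ((case constants ux x uy y um m of None \<Rightarrow> True | Some (cx, cy, cm) \<Rightarrow> solved_x ux uy um cx cy
        cm (powers_or m) (powers_or y) (powers_or x))
      \<and> checked_m ux x uy y m_candidates)"

text \<open>The ranges come from the equations containing \<open>m\<close>:
  \<open>s1 * u1 \<le> 81\<close> for \<open>um = 3\<close>, \<open>s8 \<le> 2\<close> for 5 and 15,
  \<open>s2 * u2 \<le> 3\<close> for 7.\<close>

definition m_candidates where "m_candidates = [(1, 0), (3, 1), (3, 2), (3, 4), (3, 8), (3, 16),
    (3, 32), (3, 64), (5, 1), (7, 1), (7, 2), (15, 1 :: int)]"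

text \<open>The pair \<open>ux = uy = 1\<close> is left out: it carries the infinite family and is
  settled by inequalities in \<open>exponent_system\<close>.\<close>

fun checked_y where
  "checked_y ux x [] = True"
| "checked_y ux x ((uy, y) # y_candidates) =
    ((if ux = 1 then (if uy = 1 then True else checked_m ux x uy y m_candidates) else checked_m ux
        x uy y m_candidates) \<and> checked_y ux x y_candidates)"

text \<open>Shared by \<open>x\<close> and \<open>x + 1\<close>. For odd parts 5, 7 and 15 the
  bounds 32 on \<open>r\<close> and \<open>t\<close> and 27 on \<open>p * up\<close> leave 2-parts
  up to 16; for 9 and 13 the bounds 2 on \<open>s3\<close> to \<open>s6\<close> leave only
  1.\<close>

definition linear_candidates where "linear_candidates = [(1, 0), (3, 0), (5, 1), (5, 2), (5, 4),
    (5, 8), (5, 16), (7, 1), (7, 2), (7, 4), (7, 8), (7, 16), (9, 1), (13, 1),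
   (15, 1), (15, 2), (15, 4), (15, 8), (15, 16 :: int)]"

fun checked_x where
  "checked_x [] = True"
| "checked_x ((ux, x) # rest) = (checked_y ux x linear_candidates \<and> checked_x rest)"

lemma checked_x_linear_candidates: "checked_x linear_candidates"
  by code_simp

lemma solved_mD: "solved_m ux x uy y um cx cy cm ms \<Longrightarrow> m \<in> set ms \<Longrightarrow> solved ux x uy y um m cx cy cm"
  by (induction ms) auto

lemma solved_yD: "solved_y ux x uy um cx cy cm ms ys \<Longrightarrow> y \<in> set ys \<Longrightarrow> solved_m ux x uy y um cx cy cm
    ms"
  by (induction ys) auto

lemma solved_xD: "solved_x ux uy um cx cy cm ms ys xs \<Longrightarrow> x \<in> set xs \<Longrightarrow> solved_y ux x uy um cx cy cm
    ms ys"
  by (induction xs) auto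

lemma checked_mD: "checked_m ux x uy y l \<Longrightarrow> (um, m) \<in> set l \<Longrightarrow> constants ux x uy y um m = Some (cx,
    cy, cm) \<Longrightarrow>
  solved_x ux uy um cx cy cm (powers_or m) (powers_or y) (powers_or x)"
  by (induction l) auto

lemma checked_yD: "checked_y ux x l \<Longrightarrow> (uy, y) \<in> set l \<Longrightarrow> ux \<noteq> 1 \<or> uy \<noteq> 1 \<Longrightarrow> checked_m ux x uy y
    m_candidates"
  by (induction l) (auto split: if_splits)

lemma checked_xD: "checked_x l \<Longrightarrow> (ux, x) \<in> set l \<Longrightarrow> checked_y ux x linear_candidates"
  by (induction l) auto

text \<open>The constants 23 and 15 collect the terms \<open>-1\<close> of the factors
  \<open>2 ^ h - 1\<close>, less the 1 of \<open>e + 1\<close>. Once all unknowns are bounded, the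
  table lookups in \<open>constants\<close> succeed and one evaluation covers everything but
  \<open>ux = uy = 1\<close>.\<close>

lemma exponent_system:
  fixes ux x uy y um m up p u1 s1 u2 s2 s3 s4 s5 s6 s7 s8 r t :: int
  assumes pow2: "pow2 x" "pow2 y" "pow2 m" "pow2 p" "pow2 s1" "pow2 s2" "pow2 s3" "pow2 s4" "pow2
      s5"
      "pow2 s6" "pow2 s7" "pow2 s8" "pow2 r" "pow2 t"
    and ux: "ux \<in> {1, 3, 5, 7, 9, 13, 15}" and uy: "uy \<in> {1, 3, 5, 7, 9, 13, 15}"
    and um: "um \<in> {1, 3, 5, 7, 15}"
    and up: "up \<in> {1, 3}" and u1: "u1 \<in> {1, 3}" and u2: "u2 \<in> {1, 3}"
    and p: "p * up = 1 + on (ux = 7) x + on (uy = 7) y + on (um = 7) m"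
    and s3: "s3 = 1 + on (ux = 13) x" and s4: "s4 = 1 + on (ux = 9) x"
    and s5: "s5 = 1 + on (uy = 9) y" and s6: "s6 = 1 + on (uy = 13) y"
    and s8: "s8 = 1 + on (um = 5 \<or> um = 15) m"
    and s2: "s2 * u2 = 1 + on (um = 7) m"
    and s7: "s7 = 1 + on (um = 15) m + on (u2 = 3) s2"
    and s1: "s1 * u1 = 1 + on (ux = 15) x + on (uy = 15) y + on (um = 3 \<or> um = 15) m + on (u2 = 3)
        s2"
    and r: "r = 1 + on (ux = 5 \<or> ux = 15) x + on (uy = 15) y + on (um = 15) m
        + on (up = 3) p + on (u1 = 3) s1"
    and t: "t = 1 + on (uy = 5 \<or> uy = 15) y + on (ux = 15) x + on (um = 15) m
        + on (up = 3) p + on (u1 = 3) s1"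
    and x: "x * ux = y + m
        + (3 * p + r + 3 * t + s1 + 2 * s2 + s3 + 3 * s4 + s5 + 3 * s6 + s7 + 3 * s8 - 23)"
    and y: "y * uy = x + m
        + (3 * p + 3 * r + t + s1 + 2 * s2 + 3 * s3 + s4 + 3 * s5 + s6 + s7 + 3 * s8 - 23)"
    and m: "m * um = (2 * on (up = 3) p + s1 + s2 + 4 * s3 + s4 + s5 + 4 * s6 + 3 * s7 + s8 - 15)
        + on (ux \<in> {3, 9, 15}) x + on (uy \<in> {3, 9, 15}) y"
  shows "(ux, x, uy, y, um, m) \<in> set solution_table \<or>
    ux = 1 \<and> uy = 1 \<and> um = 1 \<and> x = y \<and> m = 1 \<and> p = 1 \<and> r = 1 \<and> t = 1 \<and> s1 = 1 \<and> s2 = 1"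
proof -
  note ge = pow2[THEN pow2_ge_1]
  have on_pow2: "on b v = 0 \<or> pow2 (on b v)" if "pow2 v" for b v using that by (simp add: on_def)
  have on_ge: "0 \<le> on b v" "on b v \<le> v" if "pow2 v" for b v using pow2_ge_1[OF that] by (auto
      simp: on_def)
  note nonneg = pow2(1)[THEN on_ge(1)] pow2(2)[THEN on_ge(1)] pow2(3)[THEN on_ge(1)]
    pow2(4)[THEN on_ge(1)] pow2(5)[THEN on_ge(1)] pow2(6)[THEN on_ge(1)]
  have le3: "q * u \<le> 3 ^ length ts * c" if "\<forall>t\<in>set ts. t = 0 \<or> pow2 t" "1 \<le> c" "pow2 q" "u \<in> {1, 3}"
    "q * u = c + sum_list ts" for q u c ts
  proof -
    have "1 \<le> u" using that(4) by auto
    from sum_pow2_le[OF that(1,2) that(5)[symmetric] that(3) this]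
    have "q * u \<le> max 2 u ^ length ts * c" .
    also have "\<dots> \<le> 3 ^ length ts * c"
      using that(2,4) by (intro mult_right_mono power_mono) auto
    finally show ?thesis .
  qed
  have le2: "q \<le> 2 ^ length ts * c" if "\<forall>t\<in>set ts. t = 0 \<or> pow2 t" "1 \<le> c" "pow2 q"
    "q = c + sum_list ts" for q c ts
    using sum_pow2_le[OF that(1,2) _ that(3), of 1] that(4) by simp
  \<comment> \<open>Each bound below is a power of 3 (if an odd part 3 is possible) or of 2, with
    the number of conditional summands as exponent.\<close>
  have p_le: "p * up \<le> 27"
    using le3[of "[on (ux = 7) x, on (uy = 7) y, on (um = 7) m]" 1 p up] pow2 on_pow2 up p by simp
  have s2_le: "s2 * u2 \<le> 3" using le3[of "[on (um = 7) m]" 1 s2 u2] pow2 on_pow2 u2 s2 by simp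
  have s1_le: "s1 * u1 \<le> 81"
    using le3[of "[on (ux = 15) x, on (uy = 15) y, on (um = 3 \<or> um = 15) m, on (u2 = 3) s2]" 1 s1
        u1]
      pow2 on_pow2 u1 s1 by simp
  have s3_le: "s3 \<le> 2" using le2[of "[on (ux = 13) x]" 1 s3] pow2 on_pow2 s3 by simp
  have s4_le: "s4 \<le> 2" using le2[of "[on (ux = 9) x]" 1 s4] pow2 on_pow2 s4 by simp
  have s5_le: "s5 \<le> 2" using le2[of "[on (uy = 9) y]" 1 s5] pow2 on_pow2 s5 by simp
  have s6_le: "s6 \<le> 2" using le2[of "[on (uy = 13) y]" 1 s6] pow2 on_pow2 s6 by simp
  have s8_le: "s8 \<le> 2" using le2[of "[on (um = 5 \<or> um = 15) m]" 1 s8] pow2 on_pow2 s8 by simp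
  have s7_le: "s7 \<le> 4" using le2[of "[on (um = 15) m, on (u2 = 3) s2]" 1 s7] pow2 on_pow2 s7 by simp
  have r_le: "r \<le> 32"
    using le2[of "[on (ux = 5 \<or> ux = 15) x, on (uy = 15) y, on (um = 15) m, on (up = 3) p, on (u1
        = 3) s1]" 1 r]
      pow2 on_pow2 r by simp
  have t_le: "t \<le> 32"
    using le2[of "[on (uy = 5 \<or> uy = 15) y, on (ux = 15) x, on (um = 15) m, on (up = 3) p, on (u1
        = 3) s1]" 1 t]
      pow2 on_pow2 t by simp
  have split: "map_of split_table (q * u) = Some (q, u)" if "pow2 q" "u \<in> {1, 3}" "q * u \<le> 81" for
      q u
  proof -
    have "q < 2048" using that by auto
    from pow2_cases[OF that(1) this] that(2,3) show ?thesis
      by (simp add: split_table_def; elim disjE; simp)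
  qed
  have power: "map_of power_table q = Some q" if "pow2 q" "q \<le> 32" for q
    using pow2_cases[OF that(1)] that(2) by (simp add: power_table_def; elim disjE; simp)
  have p_le': "p \<le> 27" using p_le up ge by auto
  have s1_le': "s1 \<le> 81" using s1_le u1 ge by auto
  have s2_le': "s2 \<le> 3" using s2_le u2 ge by auto
  define cx where "cx = 3 * p + r + 3 * t + s1 + 2 * s2 + s3 + 3 * s4 + s5 + 3 * s6 + s7 + 3 * s8
      - 23"
  define cy where "cy = 3 * p + 3 * r + t + s1 + 2 * s2 + 3 * s3 + s4 + 3 * s5 + s6 + s7 + 3 * s8
      - 23"
  define cm where "cm = 2 * on (up = 3) p + s1 + s2 + 4 * s3 + s4 + s5 + 4 * s6 + 3 * s7 + s8 - 15"
  \<comment> \<open>Odd part 3 of \<open>x\<close> or \<open>x + 1\<close> enters only the equation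
    of \<open>M 1\<close>, hence not \<open>constants\<close>; those 2-parts are bounded later
    through \<open>m * um\<close>.\<close>
  define x0 where "x0 = (if ux = 1 \<or> ux = 3 then 0 else x)"
  define y0 where "y0 = (if uy = 1 \<or> uy = 3 then 0 else y)"
  define m0 where "m0 = (if um = 1 then 0 else m)"
  have on0: "on (ux = 7) x0 = on (ux = 7) x" "on (ux = 9) x0 = on (ux = 9) x" "on (ux = 13) x0 =
      on (ux = 13) x"
    "on (ux = 15) x0 = on (ux = 15) x" "on (ux = 5 \<or> ux = 15) x0 = on (ux = 5 \<or> ux = 15) x"
    "on (uy = 7) y0 = on (uy = 7) y" "on (uy = 9) y0 = on (uy = 9) y" "on (uy = 13) y0 = on (uy =
        13) y"
    "on (uy = 15) y0 = on (uy = 15) y" "on (uy = 5 \<or> uy = 15) y0 = on (uy = 5 \<or> uy = 15) y"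
    "on (um = 7) m0 = on (um = 7) m" "on (um = 15) m0 = on (um = 15) m"
    "on (um = 5 \<or> um = 15) m0 = on (um = 5 \<or> um = 15) m"
    "on (um = 3 \<or> um = 15) m0 = on (um = 3 \<or> um = 15) m"
    by (auto simp: on_def x0_def y0_def m0_def)
  have maps: "map_of split_table (p * up) = Some (p, up)" "map_of split_table (s2 * u2) = Some
      (s2, u2)"
    "map_of split_table (s1 * u1) = Some (s1, u1)" "map_of power_table r = Some r"
    "map_of power_table t = Some t" "map_of power_table s3 = Some s3" "map_of power_table s4 =
        Some s4"
    "map_of power_table s5 = Some s5" "map_of power_table s6 = Some s6" "map_of power_table s7 =
        Some s7"
    "map_of power_table s8 = Some s8"
    using split[OF pow2(4) up] split[OF pow2(6) u2] split[OF pow2(5) u1] pow2(7-14)[THEN power]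
      p_le s1_le s2_le s3_le s4_le s5_le s6_le s7_le s8_le r_le t_le by simp_all
  have constants: "constants ux x0 uy y0 um m0 = Some (cx, cy, cm)"
    unfolding constants_def on0 p[symmetric] s3[symmetric] s4[symmetric] s5[symmetric] s6[symmetric]
      s8[symmetric] s2[symmetric] maps option.case prod.case s7[symmetric] s1[symmetric]
      r[symmetric] t[symmetric] cx_def cy_def cm_def ..
  show ?thesis
  proof (cases "ux = 1 \<and> uy = 1")
    case True
    then have eqs: "x = y + m + cx" "y = x + m + cy" using x y by (simp_all add: cx_def cy_def)
    \<comment> \<open>All unknowns are at least 1, so \<open>cx\<close> and \<open>cy\<close> are at
      least -1. Adding the equations gives \<open>2 * m + cx + cy = 0\<close>, which forces equality
      everywhere.\<close>
    have all1: "m = 1" "p = 1" "r = 1" "t = 1" "s1 = 1" "s2 = 1"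
      using ge eqs unfolding cx_def cy_def by linarith+
    moreover have "s3 = 1" "s4 = 1" "s5 = 1" "s6 = 1" "s7 = 1" "s8 = 1"
      using ge eqs unfolding cx_def cy_def by linarith+
    moreover have "x = y" using ge eqs unfolding cx_def cy_def by linarith
    moreover have "up = 1" using up p all1 True by (auto simp: on_def split: if_splits)
    ultimately show ?thesis using True m by (simp add: on_def)
  next
    case False
    have "on (um = 3 \<or> um = 15) m \<le> 80"
      using s1 s1_le nonneg(1)[of "ux = 15"] nonneg(2)[of "uy = 15"] nonneg(6)[of "u2 = 3"] by
          linarith
    moreover have "on (um = 5 \<or> um = 15) m \<le> 1" using s8 s8_le by linarith
    moreover have "on (um = 7) m \<le> 2" using s2 s2_le by linarith
    ultimately have m_le: "um = 3 \<Longrightarrow> m \<le> 80" "um = 5 \<Longrightarrow> m \<le> 1" "um = 7 \<Longrightarrow> m \<le> 2" "um = 15 \<Longrightarrow> m \<le> 1"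
      by (simp_all add: on_def)
    have small: "v \<in> {1, 2, 4, 8, 16}" if "pow2 v" "v \<le> 31" for v
      using pow2_cases[OF that(1)] that(2) by (simp; elim disjE; simp)
    have m_candidates: "(um, m0) \<in> set m_candidates"
    proof -
      from um consider "um = 1" | "um = 3" | "um = 5 \<or> um = 15" | "um = 7" by blast
      then show ?thesis
      proof cases
        case 2
        then have "m \<le> 80" using m_le by simp
        then have "m \<in> {1, 2, 4, 8, 16, 32, 64}"
          using pow2_cases[OF pow2(3)] by (simp; elim disjE; simp)
        with 2 show ?thesis unfolding m_candidates_def m0_def by (simp; elim disjE; simp)
      next
        case 3
        then have "m = 1" using m_le ge(3) by (elim disjE) simp_all
        with 3 show ?thesis unfolding m_candidates_def m0_def by (elim disjE) simp_all
      next
        case 4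
        then have "m = 1 \<or> m = 2" using m_le ge(3) by linarith
        with 4 show ?thesis unfolding m_candidates_def m0_def by (elim disjE) simp_all
      qed (simp add: m_candidates_def m0_def)
    qed
    have "on (ux = 5 \<or> ux = 15) x \<le> 31" using r r_le nonneg(2)[of "uy = 15"] nonneg(3)[of "um = 15"]
        nonneg(4)[of "up = 3"] nonneg(5)[of "u1 = 3"] by linarith
    moreover have "on (ux = 7) x \<le> 26"
      using p p_le nonneg(2)[of "uy = 7"] nonneg(3)[of "um = 7"] by linarith
    moreover have "on (ux = 9) x \<le> 1" using s4 s4_le by linarith
    moreover have "on (ux = 13) x \<le> 1" using s3 s3_le by linarith
    ultimately have x_le: "ux = 5 \<Longrightarrow> x \<le> 31" "ux = 7 \<Longrightarrow> x \<le> 26" "ux = 9 \<Longrightarrow> x \<le> 1" "ux = 13 \<Longrightarrow> x \<le> 1"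
      "ux = 15 \<Longrightarrow> x \<le> 31"
      by (simp_all add: on_def)
    have "on (uy = 5 \<or> uy = 15) y \<le> 31" using t t_le nonneg(1)[of "ux = 15"] nonneg(3)[of "um = 15"]
        nonneg(4)[of "up = 3"] nonneg(5)[of "u1 = 3"] by linarith
    moreover have "on (uy = 7) y \<le> 26"
      using p p_le nonneg(1)[of "ux = 7"] nonneg(3)[of "um = 7"] by linarith
    moreover have "on (uy = 9) y \<le> 1" using s5 s5_le by linarith
    moreover have "on (uy = 13) y \<le> 1" using s6 s6_le by linarith
    ultimately have y_le: "uy = 5 \<Longrightarrow> y \<le> 31" "uy = 7 \<Longrightarrow> y \<le> 26" "uy = 9 \<Longrightarrow> y \<le> 1" "uy = 13 \<Longrightarrow> y \<le> 1"
      "uy = 15 \<Longrightarrow> y \<le> 31"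
      by (simp_all add: on_def)
    have linear_candidates: "(ux, x0) \<in> set linear_candidates"
    proof -
      from ux consider "ux = 1 \<or> ux = 3" | "ux = 5 \<or> ux = 7 \<or> ux = 15" | "ux = 9 \<or> ux = 13" by blast
      then show ?thesis
      proof cases
        case 1
        then show ?thesis unfolding linear_candidates_def x0_def by (elim disjE) simp_all
      next
        case 2
        then have "x \<le> 31" using x_le by (elim disjE) simp_all
        from small[OF pow2(1) this] have "x = 1 \<or> x = 2 \<or> x = 4 \<or> x = 8 \<or> x = 16" by simp
        with 2 show ?thesis unfolding linear_candidates_def x0_def by (elim disjE) simp_all
      next
        case 3
        then have "x = 1" using x_le ge(1) by (elim disjE) simp_all
        with 3 show ?thesis unfolding linear_candidates_def x0_def by (elim disjE) simp_all
      qed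
    qed
    have y_candidates: "(uy, y0) \<in> set linear_candidates"
    proof -
      from uy consider "uy = 1 \<or> uy = 3" | "uy = 5 \<or> uy = 7 \<or> uy = 15" | "uy = 9 \<or> uy = 13" by blast
      then show ?thesis
      proof cases
        case 1
        then show ?thesis unfolding linear_candidates_def y0_def by (elim disjE) simp_all
      next
        case 2
        then have "y \<le> 31" using y_le by (elim disjE) simp_all
        from small[OF pow2(2) this] have "y = 1 \<or> y = 2 \<or> y = 4 \<or> y = 8 \<or> y = 16" by simp
        with 2 show ?thesis unfolding linear_candidates_def y0_def by (elim disjE) simp_all
      next
        case 3
        then have "y = 1" using y_le ge(2) by (elim disjE) simp_all
        with 3 show ?thesis unfolding linear_candidates_def y0_def by (elim disjE) simp_all
      qed
    qed
    have cm: "1 \<le> cm" "cm \<le> 157"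
      using ge on_ge[OF pow2(4), of "up = 3"] p_le' s1_le' s2_le' s3_le s4_le s5_le s6_le s7_le
          s8_le
      unfolding cm_def by linarith+
    \<comment> \<open>For \<open>um = 1\<close> at most two powers of two are added to
      \<open>cm\<close>, so the total is at most 4 * 157 = 628; the other odd parts give
      less.\<close>
    have total: "m * um \<le> 628"
    proof (cases "um = 1")
      case True
      let ?ts = "[on (ux \<in> {3, 9, 15}) x, on (uy \<in> {3, 9, 15}) y]"
      have "m = cm + sum_list ?ts" using m True unfolding cm_def by simp
      moreover have "\<forall>t\<in>set ?ts. t = 0 \<or> pow2 t" using on_pow2 pow2(1,2) by simp
      ultimately have "m \<le> 2 ^ length ?ts * cm" using le2 cm(1) pow2(3) by blast
      then show ?thesis using cm(2) True by simp
    qed (use um m_le in auto)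
    have m_lt: "m < 2048" using total um ge by auto
    have "on (ux \<in> {3, 9, 15}) x \<le> 628" "on (uy \<in> {3, 9, 15}) y \<le> 628"
      using total m cm nonneg(1)[of "ux \<in> {3, 9, 15}"] nonneg(2)[of "uy \<in> {3, 9, 15}"]
      unfolding cm_def by linarith+
    then have x3: "ux = 3 \<Longrightarrow> x \<le> 628" and y3: "uy = 3 \<Longrightarrow> y \<le> 628" by (simp_all add: on_def)
    have cxy: "cx \<le> 300" "cy \<le> 300"
      using p_le' s1_le' s2_le' s3_le s4_le s5_le s6_le s7_le s8_le r_le t_le
      unfolding cx_def cy_def by linarith+
    have m_le': "m \<le> 628" using total um ge by auto
    have x_le': "x \<le> 628" if "ux \<noteq> 1" using that ux x_le x3 by auto
    have y_le': "y \<le> 628" if "uy \<noteq> 1" using that uy y_le y3 by auto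
    \<comment> \<open>For \<open>ux = 1\<close> the equation gives at most 628 + 628 + 300, which
      lies below the limit 2048 of the enumeration.\<close>
    have "x < 2048"
    proof (cases "ux = 1")
      case True
      with False y_le' have "y \<le> 628" by simp
      with x True m_le' cxy show ?thesis by (simp add: cx_def)
    qed (use x_le' in simp)
    have "y < 2048"
    proof (cases "uy = 1")
      case True
      with False x_le' have "x \<le> 628" by simp
      with y True m_le' cxy show ?thesis by (simp add: cy_def)
    qed (use y_le' in simp)
    have powers_or: "v \<in> set (powers_or (if b then 0 else v))" if "pow2 v" "v < 2048" for b v
      using pow2_cases[OF that] pow2_ge_1[OF that(1)] by (simp add: powers_or_def powers_def)
    have in_powers_or: "x \<in> set (powers_or x0)" "y \<in> set (powers_or y0)" "m \<in> set (powers_or m0)"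
      unfolding x0_def y0_def m0_def using powers_or pow2 \<open>x < 2048\<close> \<open>y < 2048\<close> m_lt by blast+
    have "checked_m ux x0 uy y0 m_candidates"
      using checked_yD[OF checked_xD[OF checked_x_linear_candidates linear_candidates]
          y_candidates] False by blast
    from checked_mD[OF this m_candidates constants]
    have "solved ux x uy y um m cx cy cm" using in_powers_or by (blast dest: solved_xD solved_yD
        solved_mD)
    then show ?thesis using x y m by (simp add: solved_def cx_def cy_def cm_def)
  qed
qed

section \<open>Multiplicities\<close>

lemma upt_30: "[0..<30::nat] = [0, 1, 2, 3, 4, 5, 6, 7, 8, 9, 10, 11, 12, 13, 14, 15, 16, 17, 18,
    19, 20, 21, 22, 23, 24, 25, 26, 27, 28, 29]"
  by code_simp

lemma sum_lessThan_30:
  fixes f :: "nat \<Rightarrow> int"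
  shows "(\<Sum>i<30. f i) = f 0 + f 1 + f 2 + f 3 + f 4 + f 5 + f 6 + f 7 + f 8 + f 9 + f 10 + f 11 +
      f 12 + f 13 + f 14 + f 15 + f 16 + f 17 + f 18 + f 19 + f 20 + f 21 + f 22 + f 23 + f 24 + f
      25 + f 26 + f 27 + f 28 + f 29"
proof -
  have "{..<30::nat} = set [0..<30]" by auto
  also note upt_30
  finally show ?thesis by (simp add: ac_simps)
qed

lemma factors_eq:
  "factors 0 u = (if u = 3 then [2] else if u = 5 then [5] else if u = 7 then [3, 4] else if u = 9
      then [2, 18] else if u = 13 then [17] else if u = 15 then [2, 5, 6, 15] else [])"
  "factors 1 u = (if u = 3 then [2] else if u = 5 then [6] else if u = 7 then [3, 4] else if u = 9
      then [2, 19] else if u = 13 then [20] else if u = 15 then [2, 5, 6, 15] else [])"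
  "factors 2 u = (if u = 3 then [15] else if u = 5 then [22] else if u = 7 then [3, 4, 16] else if
      u = 15 then [5, 6, 15, 21, 22] else [])"
  "factors 3 u = (if u = 3 then [2, 6] else [])"
  "factors 4 u = (if u = 3 then [2, 5] else [])"
  "factors 15 u = (if u = 3 then [5, 6] else [])"
  "factors 16 u = (if u = 3 then [15, 21] else [])"
  by (simp_all add: factors_def fac_geo_def)

lemma count_factors:
  "count_list (factors 0 u) 2 = of_bool (u = 3 \<or> u = 9 \<or> u = 15)"
  "count_list (factors 0 u) 3 = of_bool (u = 7)"
  "count_list (factors 0 u) 4 = of_bool (u = 7)"
  "count_list (factors 0 u) 5 = of_bool (u = 5 \<or> u = 15)"
  "count_list (factors 0 u) 6 = of_bool (u = 15)"
  "count_list (factors 0 u) 15 = of_bool (u = 15)"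
  "count_list (factors 0 u) 17 = of_bool (u = 13)"
  "count_list (factors 0 u) 18 = of_bool (u = 9)"
  "count_list (factors 1 u) 2 = of_bool (u = 3 \<or> u = 9 \<or> u = 15)"
  "count_list (factors 1 u) 3 = of_bool (u = 7)"
  "count_list (factors 1 u) 4 = of_bool (u = 7)"
  "count_list (factors 1 u) 5 = of_bool (u = 15)"
  "count_list (factors 1 u) 6 = of_bool (u = 5 \<or> u = 15)"
  "count_list (factors 1 u) 15 = of_bool (u = 15)"
  "count_list (factors 1 u) 19 = of_bool (u = 9)"
  "count_list (factors 1 u) 20 = of_bool (u = 13)"
  "count_list (factors 2 u) 3 = of_bool (u = 7)"
  "count_list (factors 2 u) 4 = of_bool (u = 7)"
  "count_list (factors 2 u) 5 = of_bool (u = 15)"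
  "count_list (factors 2 u) 6 = of_bool (u = 15)"
  "count_list (factors 2 u) 15 = of_bool (u = 3 \<or> u = 15)"
  "count_list (factors 2 u) 16 = of_bool (u = 7)"
  "count_list (factors 2 u) 21 = of_bool (u = 15)"
  "count_list (factors 2 u) 22 = of_bool (u = 5 \<or> u = 15)"
  "count_list (factors 3 u) 2 = of_bool (u = 3)"
  "count_list (factors 3 u) 6 = of_bool (u = 3)"
  "count_list (factors 4 u) 2 = of_bool (u = 3)"
  "count_list (factors 4 u) 5 = of_bool (u = 3)"
  "count_list (factors 15 u) 5 = of_bool (u = 3)"
  "count_list (factors 15 u) 6 = of_bool (u = 3)"
  "count_list (factors 16 u) 15 = of_bool (u = 3)"
  "count_list (factors 16 u) 21 = of_bool (u = 3)"
  by (simp_all add: factors_eq del: One_nat_def)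

lemma count_factors_0:
  "j \<notin> {2, 3, 4, 5, 6, 15, 17, 18} \<Longrightarrow> count_list (factors 0 u) j = 0"
  "j \<notin> {2, 3, 4, 5, 6, 15, 19, 20} \<Longrightarrow> count_list (factors 1 u) j = 0"
  "j \<notin> {3, 4, 5, 6, 15, 16, 21, 22} \<Longrightarrow> count_list (factors 2 u) j = 0"
  "j \<notin> {2, 6} \<Longrightarrow> count_list (factors 3 u) j = 0"
  "j \<notin> {2, 5} \<Longrightarrow> count_list (factors 4 u) j = 0"
  "j \<notin> {5, 6} \<Longrightarrow> count_list (factors 15 u) j = 0"
  "j \<notin> {15, 21} \<Longrightarrow> count_list (factors 16 u) j = 0"
  by (simp_all add: factors_eq del: One_nat_def)

lemma factors_Nil: "i \<notin> {0, 1, 2, 3, 4, 15, 16} \<Longrightarrow> factors i u = []"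
  by (simp add: factors_def fac_geo_def)

lemma weight_int:
  "int (weight h u j) = (\<Sum>i<30. (2 ^ h i - 1) * int (count_list (fac_succ ! i) j)
     + 2 ^ h i * int (count_list (factors i (u i)) j))"
  by (simp add: weight_def of_nat_diff)

lemma on_eq: "on b x = of_bool b * x"
  by (simp add: on_def)

text \<open>Each \<open>P + 1\<close> is a product of \<open>x\<close>, \<open>x + 1\<close> and
  \<open>M 1\<close>, so only the first three equations have terms \<open>2 ^ h - 1\<close>. Members
  7 to 14 and 23 to 29 occur in neither table, which makes their exponents vanish.\<close>

lemma weights:
  "int (weight h u 0) = (2 ^ h 1 - 1) + (2 ^ h 2 - 1) + (2 ^ h 3 - 1) + 2 * (2 ^ h 4 - 1) + (2 ^ h
      5 - 1) + 3 * (2 ^ h 6 - 1) + 3 * (2 ^ h 7 - 1) + 3 * (2 ^ h 8 - 1) + 6 * (2 ^ h 9 - 1) + 2 *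
      (2 ^ h 10 - 1) + 4 * (2 ^ h 11 - 1) + (2 ^ h 12 - 1) + (2 ^ h 13 - 1) + 8 * (2 ^ h 14 - 1) +
      (2 ^ h 15 - 1) + 2 * (2 ^ h 16 - 1) + (2 ^ h 17 - 1) + 3 * (2 ^ h 18 - 1) + (2 ^ h 19 - 1) +
      3 * (2 ^ h 20 - 1) + (2 ^ h 21 - 1) + 3 * (2 ^ h 22 - 1) + (2 ^ h 23 - 1) + 4 * (2 ^ h 24 -
      1) + (2 ^ h 25 - 1) + 2 * (2 ^ h 26 - 1) + (2 ^ h 27 - 1) + 2 * (2 ^ h 28 - 1) + (2 ^ h 29 -
      1)"
  "int (weight h u 1) = (2 ^ h 0 - 1) + (2 ^ h 2 - 1) + 2 * (2 ^ h 3 - 1) + (2 ^ h 4 - 1) + 3 * (2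
      ^ h 5 - 1) + (2 ^ h 6 - 1) + 2 * (2 ^ h 7 - 1) + 4 * (2 ^ h 8 - 1) + (2 ^ h 9 - 1) + 3 * (2
      ^ h 10 - 1) + 3 * (2 ^ h 11 - 1) + 6 * (2 ^ h 12 - 1) + 8 * (2 ^ h 13 - 1) + (2 ^ h 14 - 1)
      + (2 ^ h 15 - 1) + 2 * (2 ^ h 16 - 1) + 3 * (2 ^ h 17 - 1) + (2 ^ h 18 - 1) + 3 * (2 ^ h 19
      - 1) + (2 ^ h 20 - 1) + (2 ^ h 21 - 1) + 3 * (2 ^ h 22 - 1) + (2 ^ h 23 - 1) + (2 ^ h 24 -
      1) + 2 * (2 ^ h 25 - 1) + (2 ^ h 26 - 1) + 4 * (2 ^ h 27 - 1) + (2 ^ h 28 - 1) + 2 * (2 ^ h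
      29 - 1)"
  "int (weight h u 2) = (2 ^ h 15 - 1) + (2 ^ h 16 - 1) + 4 * (2 ^ h 17 - 1) + (2 ^ h 18 - 1) + (2
      ^ h 19 - 1) + 4 * (2 ^ h 20 - 1) + 3 * (2 ^ h 21 - 1) + (2 ^ h 22 - 1) + 5 * (2 ^ h 23 - 1)
      + (2 ^ h 24 - 1) + (2 ^ h 25 - 1) + 2 * (2 ^ h 26 - 1) + (2 ^ h 27 - 1) + (2 ^ h 28 - 1) + 2
      * (2 ^ h 29 - 1) + on (u 0 = 3 \<or> u 0 = 9 \<or> u 0 = 15) (2 ^ h 0) + on (u 1 = 3 \<or> u 1 = 9 \<or> u 1
      = 15) (2 ^ h 1) + on (u 3 = 3) (2 ^ h 3) + on (u 4 = 3) (2 ^ h 4)"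
  "int (weight h u 3) = on (u 0 = 7) (2 ^ h 0) + on (u 1 = 7) (2 ^ h 1) + on (u 2 = 7) (2 ^ h 2)"
  "int (weight h u 4) = on (u 0 = 7) (2 ^ h 0) + on (u 1 = 7) (2 ^ h 1) + on (u 2 = 7) (2 ^ h 2)"
  "int (weight h u 5) = on (u 0 = 5 \<or> u 0 = 15) (2 ^ h 0) + on (u 1 = 15) (2 ^ h 1) + on (u 2 =
      15) (2 ^ h 2) + on (u 4 = 3) (2 ^ h 4) + on (u 15 = 3) (2 ^ h 15)"
  "int (weight h u 6) = on (u 0 = 15) (2 ^ h 0) + on (u 1 = 5 \<or> u 1 = 15) (2 ^ h 1) + on (u 2 =
      15) (2 ^ h 2) + on (u 3 = 3) (2 ^ h 3) + on (u 15 = 3) (2 ^ h 15)"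
  "int (weight h u 7) = 0"
  "int (weight h u 8) = 0"
  "int (weight h u 9) = 0"
  "int (weight h u 10) = 0"
  "int (weight h u 11) = 0"
  "int (weight h u 12) = 0"
  "int (weight h u 13) = 0"
  "int (weight h u 14) = 0"
  "int (weight h u 15) = on (u 0 = 15) (2 ^ h 0) + on (u 1 = 15) (2 ^ h 1) + on (u 2 = 3 \<or> u 2 =
      15) (2 ^ h 2) + on (u 16 = 3) (2 ^ h 16)"
  "int (weight h u 16) = on (u 2 = 7) (2 ^ h 2)"
  "int (weight h u 17) = on (u 0 = 13) (2 ^ h 0)"
  "int (weight h u 18) = on (u 0 = 9) (2 ^ h 0)"
  "int (weight h u 19) = on (u 1 = 9) (2 ^ h 1)"
  "int (weight h u 20) = on (u 1 = 13) (2 ^ h 1)"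
  "int (weight h u 21) = on (u 2 = 15) (2 ^ h 2) + on (u 16 = 3) (2 ^ h 16)"
  "int (weight h u 22) = on (u 2 = 5 \<or> u 2 = 15) (2 ^ h 2)"
  "int (weight h u 23) = 0"
  "int (weight h u 24) = 0"
  "int (weight h u 25) = 0"
  "int (weight h u 26) = 0"
  "int (weight h u 27) = 0"
  "int (weight h u 28) = 0"
  "int (weight h u 29) = 0"
  unfolding weight_int sum_lessThan_30
  by (simp_all add: fac_succ_def factors_Nil count_factors count_factors_0 on_eq del: One_nat_def)

section \<open>From solutions of the system to exponents\<close>

definition expo :: "(nat \<times> nat) list \<Rightarrow> nat \<Rightarrow> nat" where
  "expo l i = (case map_of l i of None \<Rightarrow> 0 | Some n \<Rightarrow> n)"

definition perfect_expos :: "(nat \<times> nat) list list" where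
  "perfect_expos =
   [[(0, 2), (1, 1), (2, 1)],
    [(0, 1), (1, 2), (2, 1)],
    [(0, 4), (1, 3), (5, 1)],
    [(0, 3), (1, 4), (6, 1)],
    [(0, 4), (1, 4), (5, 1), (6, 1)],
    [(0, 6), (1, 3), (3, 1), (4, 1)],
    [(0, 3), (1, 6), (3, 1), (4, 1)],
    [(0, 4), (1, 6), (3, 1), (4, 1), (5, 1)],
    [(0, 6), (1, 4), (3, 1), (4, 1), (6, 1)],
    [(0, 2), (1, 1), (2, 2), (15, 1)],
    [(0, 1), (1, 2), (2, 2), (15, 1)]]"

lemma all_less_30:
  "(\<forall>i<30::nat. Q i) \<longleftrightarrow> Q 0 \<and> Q 1 \<and> Q 2 \<and> Q 3 \<and> Q 4 \<and> Q 5 \<and> Q 6 \<and> Q 7 \<and> Q 8 \<and> Q 9 \<and> Q 10 \<and> Q 11 \<and> Q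
      12 \<and> Q 13 \<and> Q 14 \<and> Q 15 \<and> Q 16 \<and> Q 17 \<and> Q 18 \<and> Q 19 \<and> Q 20 \<and> Q 21 \<and> Q 22 \<and> Q 23 \<and> Q 24 \<and> Q
      25 \<and> Q 26 \<and> Q 27 \<and> Q 28 \<and> Q 29"
proof -
  have "(\<forall>i<30. Q i) \<longleftrightarrow> list_all Q [0..<30]"
    unfolding list_all_iff set_upt by (simp add: Ball_def)
  also note upt_30
  finally show ?thesis by simp
qed

lemma admissibleD:
  assumes "admissible i u"
  shows "u = 1 \<or> (i, u) \<in> set [(0, 3), (0, 5), (0, 7), (0, 9), (0, 13), (0, 15), (1, 3), (1, 5),
      (1, 7), (1, 9), (1, 13), (1, 15), (2, 3), (2, 5), (2, 7), (2, 15), (3, 3), (4, 3), (15, 3),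
      (16, 3)]"
proof -
  have "map fst fac_geo = [(0, 3), (0, 5), (0, 7), (0, 9), (0, 13), (0, 15), (1, 3), (1, 5), (1,
      7), (1, 9), (1, 13), (1, 15), (2, 3), (2, 5), (2, 7), (2, 15), (3, 3), (4, 3), (15, 3), (16,
      3)]" by (simp add: fac_geo_def)
  moreover have "map_of fac_geo (i, u) \<noteq> None \<longleftrightarrow> (i, u) \<in> set (map fst fac_geo)"
    by (metis map_of_eq_None_iff set_map)
  ultimately show ?thesis using assms unfolding admissible_def by (simp only:)
qed

lemma pow2_power: "pow2 (2 ^ n)"
  by (auto simp: pow2_def)

text \<open>Makes the splitting into a power of two and an odd part in {1, 3} unique, so that equal
  exponents have equal parts.\<close>

lemma two_power_neq_three_mult: "(2::int) ^ a \<noteq> 3 * 2 ^ b"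
proof
  assume "(2::int) ^ a = 3 * 2 ^ b"
  then have "(3::int) dvd 2 ^ a" by simp
  then have "(3::int) dvd 2" using prime_dvd_power[of 3 "2::int" a] by simp
  then show False by simp
qed

text \<open>The first alternative contains the perfect products supported on \<open>x\<close> and
  \<open>x + 1\<close>, including the constant 1.\<close>

lemma perfect_prod_base_cases:
  assumes "perfect (\<Prod>i<30. base i ^ e i)"
  shows "(\<forall>i<30. 2 \<le> i \<longrightarrow> e i = 0) \<and> e 0 = e 1 \<or> (\<exists>l\<in>set perfect_expos. \<forall>i<30. e i = expo l i)"
proof -
  obtain h u where hu: "\<And>i. i < 30 \<Longrightarrow> Suc (e i) = 2 ^ h i * u i"
    and adm: "\<And>i. i < 30 \<Longrightarrow> admissible i (u i)" and w: "\<And>j. j < 30 \<Longrightarrow> e j = weight h u j"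
    using perfect_prod_baseD[OF assms] by metis
  define v where "v i = (2::int) ^ h i" for i
  have v_pow2: "pow2 (v i)" for i by (simp add: v_def pow2_power)
  have v_ge: "1 \<le> v i" for i by (rule pow2_ge_1[OF v_pow2])
  have eq: "v j * int (u j) = 1 + int (weight h u j)" if "j < 30" for j
    using hu[OF that] w[OF that] by (simp add: v_def flip: of_nat_Suc)
  have eint: "int (e j) = v j * int (u j) - 1" if "j < 30" for j using eq[OF that] w[OF that] by
      simp
  note weights' = weights[where h = h and u = u, folded v_def]
  have u1: "u j = 1" if "j < 30" "j \<notin> {0, 1, 2, 3, 4, 15, 16}" for j
    using admissibleD[OF adm[OF that(1)]] that(2) by simp
  have ux: "int (u 0) \<in> {1, 3, 5, 7, 9, 13, 15}" "int (u 1) \<in> {1, 3, 5, 7, 9, 13, 15}"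
    using admissibleD[OF adm[of 0]] admissibleD[OF adm[of 1]] by simp_all
  have um: "int (u 2) \<in> {1, 3, 5, 7, 15}" using admissibleD[OF adm[of 2]] by simp
  have u3: "int (u 3) \<in> {1, 3}" "int (u 4) \<in> {1, 3}" "int (u 15) \<in> {1, 3}" "int (u 16) \<in> {1, 3}"
    using admissibleD[OF adm[of 3]] admissibleD[OF adm[of 4]] admissibleD[OF adm[of 15]]
      admissibleD[OF adm[of 16]] by simp_all
  \<comment> \<open>\<open>M 2\<close> and \<open>M 3\<close> occur in the tables only together, in
    the sums with \<open>u = 7\<close>, so their equations have the same right side.\<close>
  have v34: "v 3 = v 4 \<and> u 3 = u 4"
  proof -
    have "v 3 * int (u 3) = v 4 * int (u 4)" using eq[of 3] eq[of 4] weights'(4,5) by simp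
    then show ?thesis using u3(1,2) two_power_neq_three_mult[of "h 3" "h 4"]
        two_power_neq_three_mult[of "h 4" "h 3"] by (auto simp: v_def)
  qed
  have zero: "v j = 1" if "j < 30" "int (weight h u j) = 0" "j \<notin> {0, 1, 2, 3, 4, 15, 16}" for j
    using eq[OF that(1)] u1[OF that(1,3)] that(2) by simp
  have zeros: "v 7 = 1" "v 8 = 1" "v 9 = 1" "v 10 = 1" "v 11 = 1" "v 12 = 1" "v 13 = 1" "v 14 = 1"
    "v 23 = 1" "v 24 = 1" "v 25 = 1" "v 26 = 1" "v 27 = 1" "v 28 = 1" "v 29 = 1"
    by (rule zero, simp, simp add: weights', simp)+
  have E3: "v 3 * int (u 3) = 1 + on (int (u 0) = 7) (v 0) + on (int (u 1) = 7) (v 1) + on (int (u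
      2) = 7) (v 2)"
    using eq[of 3] by (simp add: weights' zeros disj_ac del: One_nat_def)
  have E17: "v 17 = 1 + on (int (u 0) = 13) (v 0)"
    using eq[of 17] u1[of 17] by (simp add: weights' zeros disj_ac del: One_nat_def)
  have E18: "v 18 = 1 + on (int (u 0) = 9) (v 0)"
    using eq[of 18] u1[of 18] by (simp add: weights' zeros disj_ac del: One_nat_def)
  have E19: "v 19 = 1 + on (int (u 1) = 9) (v 1)"
    using eq[of 19] u1[of 19] by (simp add: weights' zeros disj_ac del: One_nat_def)
  have E20: "v 20 = 1 + on (int (u 1) = 13) (v 1)"
    using eq[of 20] u1[of 20] by (simp add: weights' zeros disj_ac del: One_nat_def)
  have E22: "v 22 = 1 + on (int (u 2) = 5 \<or> int (u 2) = 15) (v 2)"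
    using eq[of 22] u1[of 22] by (simp add: weights' zeros disj_ac del: One_nat_def)
  have E16: "v 16 * int (u 16) = 1 + on (int (u 2) = 7) (v 2)"
    using eq[of 16] by (simp add: weights' zeros disj_ac del: One_nat_def)
  have E21: "v 21 = 1 + on (int (u 2) = 15) (v 2) + on (int (u 16) = 3) (v 16)"
    using eq[of 21] u1[of 21] by (simp add: weights' zeros disj_ac del: One_nat_def)
  have E15: "v 15 * int (u 15) = 1 + on (int (u 0) = 15) (v 0) + on (int (u 1) = 15) (v 1) + on
      (int (u 2) = 3 \<or> int (u 2) = 15) (v 2)
       + on (int (u 16) = 3) (v 16)"
    using eq[of 15] by (simp add: weights' zeros disj_ac del: One_nat_def)
  have E5: "v 5 = 1 + on (int (u 0) = 5 \<or> int (u 0) = 15) (v 0) + on (int (u 1) = 15) (v 1) + on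
      (int (u 2) = 15) (v 2)
       + on (int (u 3) = 3) (v 3) + on (int (u 15) = 3) (v 15)"
    using eq[of 5] u1[of 5] v34 by (simp add: weights' zeros disj_ac del: One_nat_def)
  have E6: "v 6 = 1 + on (int (u 1) = 5 \<or> int (u 1) = 15) (v 1) + on (int (u 0) = 15) (v 0) + on
      (int (u 2) = 15) (v 2)
       + on (int (u 3) = 3) (v 3) + on (int (u 15) = 3) (v 15)"
    using eq[of 6] u1[of 6] v34 by (simp add: weights' zeros disj_ac del: One_nat_def)
  have E0: "v 0 * int (u 0) = v 1 + v 2 + (3 * v 3 + v 5 + 3 * v 6 + v 15 + 2 * v 16 + v 17 + 3 *
      v 18
       + v 19 + 3 * v 20 + v 21 + 3 * v 22 - 23)"
    using eq[of 0] v34 by (simp add: weights' zeros disj_ac del: One_nat_def)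
  have E1: "v 1 * int (u 1) = v 0 + v 2 + (3 * v 3 + 3 * v 5 + v 6 + v 15 + 2 * v 16 + 3 * v 17 +
      v 18
       + 3 * v 19 + v 20 + v 21 + 3 * v 22 - 23)"
    using eq[of 1] v34 by (simp add: weights' zeros disj_ac del: One_nat_def)
  have E2: "v 2 * int (u 2) = (2 * on (int (u 3) = 3) (v 3) + v 15 + v 16 + 4 * v 17 + v 18 + v 19
      + 4 * v 20
       + 3 * v 21 + v 22 - 15) + on (int (u 0) \<in> {3, 9, 15}) (v 0) + on (int (u 1) \<in> {3, 9, 15})
           (v 1)"
    using eq[of 2] v34 by (simp add: weights' zeros disj_ac del: One_nat_def)
  have dichotomy: "(int (u 0), v 0, int (u 1), v 1, int (u 2), v 2) \<in> set solution_table \<or>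
    int (u 0) = 1 \<and> int (u 1) = 1 \<and> int (u 2) = 1 \<and> v 0 = v 1 \<and> v 2 = 1 \<and> v 3 = 1 \<and> v 5 = 1
      \<and> v 6 = 1 \<and> v 15 = 1 \<and> v 16 = 1"
    by (rule exponent_system[OF v_pow2 v_pow2 v_pow2 v_pow2 v_pow2 v_pow2 v_pow2 v_pow2 v_pow2
        v_pow2
        v_pow2 v_pow2 v_pow2 v_pow2 ux um u3(1,3,4) E3 E17 E18 E19 E20 E22 E16 E21 E15 E5 E6 E0 E1
            E2])
  have small: "b = 1 \<and> a = n" if "a * int b = n" "int b \<in> {1, 3}" "n = 1 \<or> n = 2" for a b n
    using that by auto presburger+
  \<comment> \<open>In every solution the right sides for indices 3, 15 and 16 are 1 or 2, so odd
    part 3 never occurs there.\<close>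
  have small_terms: "int (u 2) \<noteq> 7" "on (int (u 0) = 7) (v 0) + on (int (u 1) = 7) (v 1) \<in> {0, 1}"
    "on (int (u 0) = 15) (v 0) + on (int (u 1) = 15) (v 1) + on (int (u 2) = 3 \<or> int (u 2) = 15)
        (v 2) \<in> {0, 1}"
    using dichotomy unfolding solution_table_def
    by (simp_all add: on_def; elim disjE conjE; simp)+
  have c16: "u 16 = 1" "v 16 = 1"
    using small[OF E16 u3(4)] small_terms(1) by (simp_all add: on_def)
  have c3: "u 3 = 1" "v 3 = 1 + on (int (u 0) = 7) (v 0) + on (int (u 1) = 7) (v 1)"
    using small[OF E3 u3(1)] small_terms(1,2) on_def by auto
  have c15: "u 15 = 1" "v 15 = 1 + on (int (u 0) = 15) (v 0) + on (int (u 1) = 15) (v 1)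
      + on (int (u 2) = 3 \<or> int (u 2) = 15) (v 2)"
    using small[OF E15 u3(3)] small_terms(3) c16 on_def by auto
  have c4: "u 4 = 1" "v 4 = v 3" using v34 c3(1) by metis+
  note vals = c16 c3 c15 c4 E17 E18 E19 E20 E22 E21 E5 E6 zeros
  have expoI: ?thesis if "\<forall>i<30. int (weight h u i) = int (expo l i)" "l \<in> set perfect_expos" for l
    using that w by (intro disjI2 bexI[of _ l]) simp_all
  from dichotomy consider
"u 0 = 3" "v 0 = 1" "u 1 = 1" "v 1 = 2" "u 2 = 1" "v 2 = 2"
    | "u 0 = 1" "v 0 = 2" "u 1 = 3" "v 1 = 1" "u 2 = 1" "v 2 = 2"
    | "u 0 = 5" "v 0 = 1" "u 1 = 1" "v 1 = 4" "u 2 = 1" "v 2 = 1"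
    | "u 0 = 1" "v 0 = 4" "u 1 = 5" "v 1 = 1" "u 2 = 1" "v 2 = 1"
    | "u 0 = 5" "v 0 = 1" "u 1 = 5" "v 1 = 1" "u 2 = 1" "v 2 = 1"
    | "u 0 = 7" "v 0 = 1" "u 1 = 1" "v 1 = 4" "u 2 = 1" "v 2 = 1"
    | "u 0 = 1" "v 0 = 4" "u 1 = 7" "v 1 = 1" "u 2 = 1" "v 2 = 1"
    | "u 0 = 5" "v 0 = 1" "u 1 = 7" "v 1 = 1" "u 2 = 1" "v 2 = 1"
    | "u 0 = 7" "v 0 = 1" "u 1 = 5" "v 1 = 1" "u 2 = 1" "v 2 = 1"
    | "u 0 = 3" "v 0 = 1" "u 1 = 1" "v 1 = 2" "u 2 = 3" "v 2 = 1"
    | "u 0 = 1" "v 0 = 2" "u 1 = 3" "v 1 = 1" "u 2 = 3" "v 2 = 1"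
    | "u 0 = 1" "u 1 = 1" "u 2 = 1" "v 0 = v 1" "v 2 = 1"
    unfolding solution_table_def by simp (elim disjE conjE; simp)
  then show ?thesis
  proof cases
    case 1
    have "\<forall>i<30. int (weight h u i) = int (expo [(0, 2), (1, 1), (2, 1)] i)"
      unfolding all_less_30 weights' by (simp add: 1 vals on_def expo_def del: One_nat_def)
    then show ?thesis by (rule expoI) (simp add: perfect_expos_def)
  next
    case 2
    have "\<forall>i<30. int (weight h u i) = int (expo [(0, 1), (1, 2), (2, 1)] i)"
      unfolding all_less_30 weights' by (simp add: 2 vals on_def expo_def del: One_nat_def)
    then show ?thesis by (rule expoI) (simp add: perfect_expos_def)
  next
    case 3
    have "\<forall>i<30. int (weight h u i) = int (expo [(0, 4), (1, 3), (5, 1)] i)"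
      unfolding all_less_30 weights' by (simp add: 3 vals on_def expo_def del: One_nat_def)
    then show ?thesis by (rule expoI) (simp add: perfect_expos_def)
  next
    case 4
    have "\<forall>i<30. int (weight h u i) = int (expo [(0, 3), (1, 4), (6, 1)] i)"
      unfolding all_less_30 weights' by (simp add: 4 vals on_def expo_def del: One_nat_def)
    then show ?thesis by (rule expoI) (simp add: perfect_expos_def)
  next
    case 5
    have "\<forall>i<30. int (weight h u i) = int (expo [(0, 4), (1, 4), (5, 1), (6, 1)] i)"
      unfolding all_less_30 weights' by (simp add: 5 vals on_def expo_def del: One_nat_def)
    then show ?thesis by (rule expoI) (simp add: perfect_expos_def)
  next
    case 6
    have "\<forall>i<30. int (weight h u i) = int (expo [(0, 6), (1, 3), (3, 1), (4, 1)] i)"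
      unfolding all_less_30 weights' by (simp add: 6 vals on_def expo_def del: One_nat_def)
    then show ?thesis by (rule expoI) (simp add: perfect_expos_def)
  next
    case 7
    have "\<forall>i<30. int (weight h u i) = int (expo [(0, 3), (1, 6), (3, 1), (4, 1)] i)"
      unfolding all_less_30 weights' by (simp add: 7 vals on_def expo_def del: One_nat_def)
    then show ?thesis by (rule expoI) (simp add: perfect_expos_def)
  next
    case 8
    have "\<forall>i<30. int (weight h u i) = int (expo [(0, 4), (1, 6), (3, 1), (4, 1), (5, 1)] i)"
      unfolding all_less_30 weights' by (simp add: 8 vals on_def expo_def del: One_nat_def)
    then show ?thesis by (rule expoI) (simp add: perfect_expos_def)
  next
    case 9
    have "\<forall>i<30. int (weight h u i) = int (expo [(0, 6), (1, 4), (3, 1), (4, 1), (6, 1)] i)"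
      unfolding all_less_30 weights' by (simp add: 9 vals on_def expo_def del: One_nat_def)
    then show ?thesis by (rule expoI) (simp add: perfect_expos_def)
  next
    case 10
    have "\<forall>i<30. int (weight h u i) = int (expo [(0, 2), (1, 1), (2, 2), (15, 1)] i)"
      unfolding all_less_30 weights' by (simp add: 10 vals on_def expo_def del: One_nat_def)
    then show ?thesis by (rule expoI) (simp add: perfect_expos_def)
  next
    case 11
    have "\<forall>i<30. int (weight h u i) = int (expo [(0, 1), (1, 2), (2, 2), (15, 1)] i)"
      unfolding all_less_30 weights' by (simp add: 11 vals on_def expo_def del: One_nat_def)
    then show ?thesis by (rule expoI) (simp add: perfect_expos_def)
  next
    case 12
    have "\<forall>i<30. 2 \<le> i \<longrightarrow> int (weight h u i) = 0"
      unfolding all_less_30 weights' by (simp add: 12 vals on_def del: One_nat_def)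
    moreover have "int (weight h u 0) = int (weight h u 1)"
      unfolding weights' by (simp add: 12 vals on_def del: One_nat_def)
    ultimately show ?thesis using w by (intro disjI1) simp
  qed
qed

section \<open>The theorem\<close>

lemma base_eq_linear: "base 0 = X" "base 1 = X + 1"
  by (simp_all add: base_def base_bits_def one_pCons)

lemma base_eq_M:
  "base 2 = M 1" "base 3 = M 2" "base 4 = M 3" "base 5 = M 4" "base 6 = M 5" "base 7 = M 6" "base
      8 = M 7"
  "base 9 = M 8" "base 10 = M 9" "base 11 = M 10" "base 12 = M 11" "base 13 = M 12" "base 14 = M 13"
  by (simp_all add: base_def base_bits_def M_def bar_def eval_nat_numeral one_pCons pcompose_pCons)

lemma base_eq_S:
  "base 15 = S 1" "base 16 = S 2" "base 17 = S 3" "base 18 = S 4" "base 19 = S 5" "base 20 = S 6"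
      "base 21 = S 7"
  "base 22 = S 8" "base 23 = S 9" "base 24 = S 10" "base 25 = S 11" "base 26 = S 12" "base 27 = S
      13"
  "base 28 = S 14" "base 29 = S 15"
  by (simp_all add: base_def base_bits_def S_def triple_def M_def eval_nat_numeral one_pCons)

lemma bar_mult: "bar (p * q) = bar p * bar q"
  by (simp add: bar_def pcompose_mult)

lemma bar_power: "bar (p ^ n) = bar p ^ n"
proof (induction n)
  case 0
  show ?case by (simp add: bar_def one_pCons)
qed (simp add: bar_mult)

lemma bar_base: "bar (base 0) = base 1" "bar (base 1) = base 0" "bar (base 2) = base 2" "bar (base
    3) = base 4"
  "bar (base 4) = base 3" "bar (base 5) = base 6" "bar (base 6) = base 5" "bar (base 15) = base 15"
  by (simp_all add: base_def base_bits_def bar_def one_pCons pcompose_pCons)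

lemma prod_lessThan_30:
  fixes f :: "nat \<Rightarrow> bit poly"
  shows "(\<Prod>i<30. f i) = f 0 * f 1 * f 2 * f 3 * f 4 * f 5 * f 6 * f 7 * f 8 * f 9 * f 10 * f 11 *
      f 12 * f 13 * f 14 * f 15 * f 16 * f 17 * f 18 * f 19 * f 20 * f 21 * f 22 * f 23 * f 24 * f
      25 * f 26 * f 27 * f 28 * f 29"
proof -
  have "{..<30::nat} = set [0..<30]" by auto
  also note upt_30
  finally show ?thesis by (simp add: ac_simps)
qed

definition prod_expo :: "(nat \<times> nat) list \<Rightarrow> bit poly" where
  "prod_expo l = (\<Prod>i<30. base i ^ expo l i)"

lemma map_prod_expo: "map prod_expo perfect_expos = map (\<lambda>k. T (Suc k)) [0..<11]"
proof -
  have "prod_expo l = prod_list (map (\<lambda>(i, n). base i ^ n) l)" if "l \<in> set perfect_expos" for l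
    using that unfolding perfect_expos_def prod_expo_def prod_lessThan_30
    by (simp, elim disjE) (simp_all add: expo_def mult.assoc del: One_nat_def)
  then have "map prod_expo perfect_expos = map (\<lambda>l. prod_list (map (\<lambda>(i, n). base i ^ n) l))
      perfect_expos"
    by simp
  also have "\<dots> = map (\<lambda>k. T (Suc k)) [0..<11]"
  proof -
    \<comment> \<open>The quartic factor of \<open>T 10\<close> and \<open>T 11\<close> is
      \<open>S 1\<close>.\<close>
    have x4: "X ^ 4 + X + 1 = base 15" by (simp add: base_def base_bits_def eval_nat_numeral
        one_pCons)
    have "[0..<11::nat] = [0, 1, 2, 3, 4, 5, 6, 7, 8, 9, 10]" by code_simp
    then show ?thesis
      unfolding T_def x4 base_eq_M(1,2,4)[symmetric] base_eq_linear(2)[symmetric]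
      unfolding base_eq_linear(1)[symmetric]
      by (simp add: perfect_expos_def bar_mult bar_power bar_base ac_simps del: One_nat_def)
  qed
  finally show ?thesis .
qed

lemma set_prod_expo: "prod_expo ` set perfect_expos = T ` {1..11}"
proof -
  have "prod_expo ` set perfect_expos = set (map (\<lambda>k. T (Suc k)) [0..<11])"
    unfolding map_prod_expo[symmetric] by simp
  also have "\<dots> = T ` Suc ` {0..<11}" by (simp only: set_map set_upt image_image)
  also have "Suc ` {0..<11} = {1..11}" by (auto simp: image_Suc_atLeastLessThan)
  finally show ?thesis .
qed

lemma perfect_prod_expo:
  assumes "l \<in> set perfect_expos"
  shows "perfect (prod_expo l)"
proof -
  \<comment> \<open>Only the exponents 0, 1, 2, 3, 4 and 6 occur; \<open>h\<close> and
    \<open>u\<close> split \<open>n + 1\<close> as functions of the exponent \<open>n\<close>, not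
    of the index.\<close>
  define h :: "nat \<Rightarrow> nat" where "h n = (if n = 1 then 1 else if n = 3 then 2 else 0)" for n
  define u :: "nat \<Rightarrow> nat" where "u n = (if n = 2 then 3 else if n = 4 then 5 else if n = 6 then 7
      else 1)" for n
  have hu: "\<forall>i<30. Suc (expo l i) = 2 ^ h (expo l i) * u (expo l i) \<and> admissible i (u (expo l i))"
    using assms unfolding perfect_expos_def all_less_30
    by (simp, elim disjE) (simp_all add: expo_def h_def u_def admissible_def fac_geo_def)
  have "\<forall>j<30. int (expo l j) = int (weight (\<lambda>i. h (expo l i)) (\<lambda>i. u (expo l i)) j)"
    using assms unfolding perfect_expos_def all_less_30 weights
    by (simp, elim disjE) (simp_all add: expo_def h_def u_def on_def)
  then have "\<forall>j<30. expo l j = weight (\<lambda>i. h (expo l i)) (\<lambda>i. u (expo l i)) j"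
    by (simp only: of_nat_eq_iff)
  then show ?thesis
    unfolding prod_expo_def using perfect_prod_base_iff[of "expo l" "\<lambda>i. h (expo l i)" "\<lambda>i. u
        (expo l i)"] hu
    by blast
qed

lemma bar_bar: "bar (bar p) = p"
proof -
  have "pcompose (X + 1) (X + 1) = (X :: bit poly)" by (simp add: one_pCons pcompose_pCons)
  then show ?thesis by (simp add: bar_def pcompose_assoc[symmetric])
qed

text \<open>\<open>bar\<close> is an involution that fixes \<open>T 5\<close> and exchanges the
  other members in consecutive pairs.\<close>

lemma bar_mem_T:
  assumes "p \<in> T ` {1..11}" shows "bar p \<in> T ` {1..11}"
proof -
  have self: "bar (T 5) = T 5"
    by (simp add: T_def bar_mult bar_power bar_bar) (simp add: bar_def one_pCons pcompose_pCons
        ac_simps)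
  have even: "T 2 = bar (T 1)" "T 4 = bar (T 3)" "T 7 = bar (T 6)" "T 9 = bar (T 8)" "T 11 = bar
      (T 10)"
    by (simp_all add: T_def)
  obtain k where "p = T k" "k \<in> {1..11}" using assms by blast
  then have "k = 1 \<or> k = 2 \<or> k = 3 \<or> k = 4 \<or> k = 5 \<or> k = 6 \<or> k = 7 \<or> k = 8 \<or> k = 9 \<or> k = 10 \<or> k =
      11"
    by (simp only: atLeastAtMost_iff) presburger
  then obtain k' where "k' \<in> {1..11}" "bar (T k) = T k'"
  proof (elim disjE)
    assume "k = 1" then show ?thesis using that[of 2] even by simp
  next
    assume "k = 2" then show ?thesis using that[of 1] even bar_bar by simp
  next
    assume "k = 3" then show ?thesis using that[of 4] even by simp
  next
    assume "k = 4" then show ?thesis using that[of 3] even bar_bar by simp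
  next
    assume "k = 5" then show ?thesis using that[of 5] self by simp
  next
    assume "k = 6" then show ?thesis using that[of 7] even by simp
  next
    assume "k = 7" then show ?thesis using that[of 6] even bar_bar by simp
  next
    assume "k = 8" then show ?thesis using that[of 9] even by simp
  next
    assume "k = 9" then show ?thesis using that[of 8] even bar_bar by simp
  next
    assume "k = 10" then show ?thesis using that[of 11] even by simp
  next
    assume "k = 11" then show ?thesis using that[of 10] even bar_bar by simp
  qed
  then show ?thesis using \<open>p = T k\<close> by blast
qed

lemma X_dvd_perfect:
  assumes "perfect (\<Prod>i<30. base i ^ e i)" "degree (\<Prod>i<30. base i ^ e i) > 0"
  shows "X dvd (\<Prod>i<30. base i ^ e i)"
proof -
  have "e 0 > 0"
  proof (rule ccontr)
    assume z: "\<not> e 0 > 0"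
    from perfect_prod_base_cases[OF assms(1)] show False
    proof
      assume "(\<forall>i<30. 2 \<le> i \<longrightarrow> e i = 0) \<and> e 0 = e 1"
      then have "\<forall>i<30. e i = 0" using z by (metis One_nat_def Suc_1 Suc_leI gr0I
          le_neq_implies_less less_one)
      then have "(\<Prod>i<30. base i ^ e i) = 1" by simp
      with assms(2) show False by simp
    next
      assume "\<exists>l\<in>set perfect_expos. \<forall>i<30. e i = expo l i"
      then obtain l where "l \<in> set perfect_expos" "e 0 = expo l 0" by auto
      with z show False unfolding perfect_expos_def by (simp, elim disjE) (simp_all add: expo_def)
    qed
  qed
  then have "base 0 ^ 1 dvd (\<Prod>i<30. base i ^ e i)" by (subst base.P_power_dvd_prod_iff) auto
  then show ?thesis by (simp add: base_eq_linear)
qed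

lemma prod_lessThan_add:
  fixes f :: "nat \<Rightarrow> 'a :: comm_monoid_mult"
  shows "(\<Prod>i<m + n. f i) = (\<Prod>i<m. f i) * (\<Prod>i<n. f (m + i))"
  by (induction n) (simp_all add: mult.assoc)

theorem theorem1p1:
  fixes a b :: nat and c d :: "nat \<Rightarrow> nat" and A A1 :: "bit poly"
  assumes "a \<ge> 1" and "b \<ge> 1"
    and "A1 = (\<Prod>i=1..13. M i ^ c i) * (\<Prod>j=1..15. S j ^ d j)"
    and "A1 \<noteq> 1"
    and "A = X ^ a * (X + 1) ^ b * A1"
  shows "(perfect A \<longleftrightarrow> A \<in> T ` {1..11} \<and> bar A \<in> T ` {1..11}) \<and>
         (indecomposable_perfect A \<longleftrightarrow> A \<in> T ` {1..11} \<and> bar A \<in> T ` {1..11})"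
proof -
  \<comment> \<open>\<open>M 1\<close> sits at index 2 and \<open>S 1\<close> at index 15, hence the
    shifts by 1 and 14.\<close>
  define e where "e i = (if i = 0 then a else if i = 1 then b else if i < 15 then c (i - 1) else d
      (i - 14))" for i
  have A1: "A1 = (\<Prod>k<13. base (2 + k) ^ e (2 + k)) * (\<Prod>k<15. base (15 + k) ^ e (15 + k))"
  proof -
    have "base (2 + k) = M (k + 1)" if "k < 13" for k
    proof -
      have "k = 0 \<or> k = 1 \<or> k = 2 \<or> k = 3 \<or> k = 4 \<or> k = 5 \<or> k = 6 \<or> k = 7 \<or> k = 8 \<or> k = 9
        \<or> k = 10 \<or> k = 11 \<or> k = 12" using that by presburger
      then show ?thesis by (elim disjE) (simp_all add: base_eq_M del: One_nat_def)
    qed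
    moreover have "base (15 + k) = S (k + 1)" if "k < 15" for k
    proof -
      have "k = 0 \<or> k = 1 \<or> k = 2 \<or> k = 3 \<or> k = 4 \<or> k = 5 \<or> k = 6 \<or> k = 7 \<or> k = 8 \<or> k = 9
        \<or> k = 10 \<or> k = 11 \<or> k = 12 \<or> k = 13 \<or> k = 14" using that by presburger
      then show ?thesis by (elim disjE) (simp_all add: base_eq_S del: One_nat_def)
    qed
    ultimately show ?thesis unfolding assms(3)
      by (simp add: prod.atLeast1_atMost_eq e_def)
  qed
  have A: "A = (\<Prod>i<30. base i ^ e i)"
  proof -
    have "(\<Prod>i<30. base i ^ e i) = (\<Prod>i<2 + (13 + 15). base i ^ e i)" by simp
    also have "\<dots> = base 0 ^ e 0 * base 1 ^ e 1 * A1"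
      unfolding prod_lessThan_add A1 by (simp add: numeral_2_eq_2 add.assoc)
    also have "\<dots> = A" unfolding assms(5) base_eq_linear by (simp add: e_def)
    finally show ?thesis ..
  qed
  have perfect_iff: "perfect A \<longleftrightarrow> A \<in> T ` {1..11}"
  proof
    assume "perfect A"
    then have p: "perfect (\<Prod>i<30. base i ^ e i)" by (simp add: A)
    from perfect_prod_base_cases[OF p] show "A \<in> T ` {1..11}"
    proof
      assume "(\<forall>i<30. 2 \<le> i \<longrightarrow> e i = 0) \<and> e 0 = e 1"
      \<comment> \<open>The family on \<open>x\<close> and \<open>x + 1\<close> alone is excluded by
        \<open>A1 \<noteq> 1\<close>.\<close>
      then have "A1 = 1" unfolding A1 by simp
      with assms(4) show ?thesis by simp
    next
      assume "\<exists>l\<in>set perfect_expos. \<forall>i<30. e i = expo l i"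
      then obtain l where l: "l \<in> set perfect_expos" "\<forall>i<30. e i = expo l i" by blast
      have "A = prod_expo l" unfolding A prod_expo_def by (rule prod.cong) (use l in auto)
      with l(1) show ?thesis unfolding set_prod_expo[symmetric] by blast
    qed
  next
    assume "A \<in> T ` {1..11}"
    then show "perfect A" unfolding set_prod_expo[symmetric] using perfect_prod_expo by blast
  qed
  have "\<not> (\<exists>B C. A = B * C \<and> coprime B C \<and> degree B > 0 \<and> degree C > 0 \<and> perfect B \<and> perfect C)"
  proof
    assume "\<exists>B C. A = B * C \<and> coprime B C \<and> degree B > 0 \<and> degree C > 0 \<and> perfect B \<and> perfect C"
    then obtain B C where BC: "A = B * C" "coprime B C" "degree B > 0" "degree C > 0" "perfect B"
        "perfect C"
      by blast
    have "X dvd D" if D: "D dvd A" "perfect D" "degree D > 0" for D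
    proof -
      \<comment> \<open>The classification holds for arbitrary exponents, so it applies to every
        divisor of \<open>A\<close> as well.\<close>
      obtain g where "D = (\<Prod>i<30. base i ^ g i)" using base.dvd_prod_P D(1) unfolding A by blast
      with X_dvd_perfect D(2,3) show ?thesis by blast
    qed
    then have "X dvd B" "X dvd C" using BC by simp_all
    with BC(2) have "is_unit X" using coprime_common_divisor by blast
    then have "X = 1" by simp
    from arg_cong[OF this, of degree] show False by simp
  qed
  then have "indecomposable_perfect A \<longleftrightarrow> perfect A" by (simp add: indecomposable_perfect_def)
  with perfect_iff bar_mem_T show ?thesis by blast
qed

end
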